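(* Let $N=\begin{pmatrix}0&-L_-\\L_+&0\end{pmatrix}$ with $L_+=-\partial_{xx}-g(x)$, $L_-=-\partial_{xx}-h(x)$ on $[0,\ell]$ with Dirichlet boundary conditions, where $g,h$ are arbitrary real-valued $C^2$ functions. If $\dim\ker(N)=1$, then there exists a smooth function $s(\lambda)$, defined for real $|\lambda|\ll1$, such that $s(0)=1$ and $\lambda$ is an eigenvalue of the problem $$N\mathbf u=\lambda\mathbf u\ \text{ on }[0,s(\lambda)\ell],\qquad \mathbf u(0)=\mathbf u(s(\lambda)\ell)=0 .$$ Moreover $\dot s(0)=0$, and the concavity of $s(\lambda)$ can be determined as follows (dot denotes $d/d\lambda$): (1) If $0\in\operatorname{Spec}(L_-)\setminus\operatorname{Spec}(L_+)$ with eigenfunction $v\in\ker(L_-)$, then $$\ddot s(0)=\frac2\ell\,\frac{\langle\widehat u,v\rangle}{(v'(\ell))^2},$$ where $\widehat u\in H^2(0,\ell)\cap H^1_0(0,\ell)$ is the unique solution to $L_+\widehat u=v$. (2) If $0\in\operatorname{Spec}(L_+)\setminus\operatorname{Spec}(L_-)$ with eigenfunction $u\in\ker(L_+)$, then $$\ddot s(0)=-\frac2\ell\,\frac{\langle\widehat v,u\rangle}{(u'(\ell))^2},$$ where $\widehat v\in H^2(0,\ell)\cap H^1_0(0,\ell)$ is the unique solution to $-L_-\widehat v=u$.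
   Context: $\ell>0$; $L_\pm$ are unbounded operators in $L^2(0,\ell)$ with domain $H^2(0,\ell)\cap H^1_0(0,\ell)$, and $N$ acts in $L^2(0,\ell)\times L^2(0,\ell)$ with domain $(H^2(0,\ell)\cap H^1_0(0,\ell))^2$. $\operatorname{Spec}$ denotes the spectrum, $\langle\cdot,\cdot\rangle$ is the $L^2(0,\ell)$ inner product, a prime denotes $d/dx$, and eigenfunctions are real-valued. In the problem on $[0,s\ell]$, $N$ denotes the differential expression, and an eigenvalue is a value of $\lambda$ for which the problem has a nontrivial solution $\mathbf u$. Since $s(\lambda)$ may exceed $1$, the potentials $g,h$ are taken to be defined and $C^2$ on $[0,\ell']$ for some $\ell'>\ell$.
   Formalization: "Smooth function s(λ)" is replaced by: s is C^{k+2} whenever g, h are C^k on [0,ℓ'] (so C^4 for C^2 potentials, C^∞ for C^∞ ones), since for potentials that are only C^2 the curve s need not be C^∞. *)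

theory Defs
  imports "HOL-Analysis.Analysis" "HOL-Library.Function_Algebras"
begin

text \<open>Pointwise scalar multiplication; with it, the library's \<open>dim\<close> applies to sets of (pairs of)
  real functions.\<close>

instantiation "fun" :: (type, real_vector) real_vector
begin

definition scaleR_fun :: "real \<Rightarrow> ('a \<Rightarrow> 'b) \<Rightarrow> 'a \<Rightarrow> 'b" where
  "scaleR_fun c f = (\<lambda>x. c *\<^sub>R f x)"

instance
  by standard (auto simp: scaleR_fun_def plus_fun_def fun_eq_iff algebra_simps)

end


section \<open>Functions of class \<open>C\<^sup>k\<close>\<close>

text \<open>At end points belonging to \<open>S\<close> the derivatives are one-sided.\<close>

primrec Ck_on :: "nat \<Rightarrow> real set \<Rightarrow> (real \<Rightarrow> real) \<Rightarrow> bool" where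
  "Ck_on 0 S f \<longleftrightarrow> continuous_on S f"
| "Ck_on (Suc k) S f \<longleftrightarrow>
     (\<exists>f'. (\<forall>x\<in>S. (f has_real_derivative f' x) (at x within S)) \<and> Ck_on k S f')"


section \<open>The spaces \<open>L\<^sup>2(0,l)\<close>, \<open>H\<^sup>2(0,l)\<close> and \<open>H\<^sup>1\<^sub>0(0,l)\<close>\<close>

text \<open>Elements of \<open>L\<^sup>2(0,l)\<close> are represented by functions on the real line, of which only the values
  almost everywhere in \<open>(0,l)\<close> matter.\<close>

definition L2 :: "real \<Rightarrow> (real \<Rightarrow> real) set" where
  "L2 l = {f \<in> borel_measurable (lebesgue_on {0<..<l}).
             integrable (lebesgue_on {0<..<l}) (\<lambda>x. (f x)\<^sup>2)}"

definition l2_inner :: "real \<Rightarrow> (real \<Rightarrow> real) \<Rightarrow> (real \<Rightarrow> real) \<Rightarrow> real" where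
  "l2_inner l f g = (LINT x|lebesgue_on {0<..<l}. f x * g x)"

definition l2_norm :: "real \<Rightarrow> (real \<Rightarrow> real) \<Rightarrow> real" where
  "l2_norm l f = sqrt (l2_inner l f f)"

text \<open>\<open>f\<close> is an absolutely continuous function on \<open>[0,l]\<close> with derivative \<open>f' \<in> L\<^sup>2(0,l)\<close>; that is,
  \<open>f\<close> is the continuous representative of an element of \<open>H\<^sup>1(0,l)\<close> with weak derivative \<open>f'\<close>.\<close>

definition H1_deriv :: "real \<Rightarrow> (real \<Rightarrow> real) \<Rightarrow> (real \<Rightarrow> real) \<Rightarrow> bool" where
  "H1_deriv l f f' \<longleftrightarrow>
     f' \<in> L2 l \<and> (\<forall>x\<in>{0..l}. f x = f 0 + (LINT t|lebesgue_on {0<..<x}. f' t))"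

text \<open>Sobolev classes are identified with their continuous representatives on \<open>[0,l]\<close>, extended by
  zero. Equality in \<open>H1\<close>, \<open>H2\<close>, \<open>H10\<close> is thus equality of functions.\<close>

definition H1 :: "real \<Rightarrow> (real \<Rightarrow> real) set" where
  "H1 l = {f. (\<forall>x. x \<notin> {0..l} \<longrightarrow> f x = 0) \<and> (\<exists>f1. H1_deriv l f f1)}"

definition H10 :: "real \<Rightarrow> (real \<Rightarrow> real) set" where
  "H10 l = {f \<in> H1 l. f 0 = 0 \<and> f l = 0}"

definition H2 :: "real \<Rightarrow> (real \<Rightarrow> real) set" where
  "H2 l = {f \<in> H1 l. \<exists>f1 f2. H1_deriv l f f1 \<and> H1_deriv l f1 f2}"


section \<open>Unbounded operators\<close>

text \<open>Operators are given by their graphs. The first components are the representatives chosen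
  above; the second ones are arbitrary representatives of elements of \<open>L\<^sup>2(0,l)\<close>.\<close>

definition schrodinger ::
    "real \<Rightarrow> (real \<Rightarrow> real) \<Rightarrow> ((real \<Rightarrow> real) \<times> (real \<Rightarrow> real)) set" where
  "schrodinger l q =
     {(f, w). f \<in> H2 l \<inter> H10 l \<and> w \<in> L2 l \<and>
        (\<exists>f1 f2. H1_deriv l f f1 \<and> H1_deriv l f1 f2 \<and>
           (AE x in lebesgue_on {0<..<l}. w x = - f2 x - q x * f x))}"

text \<open>With \<open>L\<^sub>+ = schrodinger l g\<close> and \<open>L\<^sub>- = schrodinger l h\<close>, this is
  \<open>N (u, v) = (- L\<^sub>- v, L\<^sub>+ u)\<close>.\<close>

definition opN ::
    "real \<Rightarrow> (real \<Rightarrow> real) \<Rightarrow> (real \<Rightarrow> real) \<Rightarrow>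
      (((real \<Rightarrow> real) \<times> (real \<Rightarrow> real)) \<times> ((real \<Rightarrow> real) \<times> (real \<Rightarrow> real))) set" where
  "opN l g h = {((u, v), (p, q)). (v, - p) \<in> schrodinger l h \<and> (u, q) \<in> schrodinger l g}"

definition ker :: "('a \<times> 'b::zero) set \<Rightarrow> 'a set" where
  "ker A = {f. (f, 0) \<in> A}"

text \<open>\<open>(f, w + z *\<^sub>R f) \<in> A\<close> says that \<open>(A - z) f = w\<close>.\<close>

definition resolvent_set ::
    "real \<Rightarrow> ((real \<Rightarrow> real) \<times> (real \<Rightarrow> real)) set \<Rightarrow> real set" where
  "resolvent_set l A =
     {z. (\<forall>w\<in>L2 l. \<exists>!f. (f, w + z *\<^sub>R f) \<in> A) \<and>
         (\<exists>C. \<forall>w\<in>L2 l. \<forall>f. (f, w + z *\<^sub>R f) \<in> A \<longrightarrow> l2_norm l f \<le> C * l2_norm l w)}"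

definition Spec :: "real \<Rightarrow> ((real \<Rightarrow> real) \<times> (real \<Rightarrow> real)) set \<Rightarrow> real set" where
  "Spec l A = - resolvent_set l A"


section \<open>The eigenvalue problem on \<open>[0,X]\<close>\<close>

text \<open>\<open>u\<close>, \<open>v\<close> is a classical solution of \<open>- L\<^sub>- v = z u\<close>, \<open>L\<^sub>+ u = z v\<close> on \<open>[0,X]\<close>, for the
  differential expressions \<open>L\<^sub>+ u = - u'' - g u\<close> and \<open>L\<^sub>- v = - v'' - h v\<close>.\<close>

definition solves_N ::
    "(real \<Rightarrow> real) \<Rightarrow> (real \<Rightarrow> real) \<Rightarrow> real \<Rightarrow> real \<Rightarrow> (real \<Rightarrow> real) \<Rightarrow> (real \<Rightarrow> real) \<Rightarrow> bool" where
  "solves_N g h X z u v \<longleftrightarrow>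
     (\<exists>u1 u2 v1 v2. \<forall>x\<in>{0..X}.
        (u has_real_derivative u1 x) (at x within {0..X}) \<and>
        (u1 has_real_derivative u2 x) (at x within {0..X}) \<and>
        (v has_real_derivative v1 x) (at x within {0..X}) \<and>
        (v1 has_real_derivative v2 x) (at x within {0..X}) \<and>
        - (- v2 x - h x * v x) = z * u x \<and>
        - u2 x - g x * u x = z * v x)"

definition dirichlet_eigenvalue ::
    "(real \<Rightarrow> real) \<Rightarrow> (real \<Rightarrow> real) \<Rightarrow> real \<Rightarrow> real \<Rightarrow> bool" where
  "dirichlet_eigenvalue g h X z \<longleftrightarrow>
     (\<exists>u v. solves_N g h X z u v \<and> u 0 = 0 \<and> v 0 = 0 \<and> u X = 0 \<and> v X = 0 \<and>
        (\<exists>x\<in>{0..X}. u x \<noteq> 0 \<or> v x \<noteq> 0))"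

text \<open>Smoothness of an eigenvalue curve \<open>s\<close> on \<open>(-r,r)\<close>, for potentials \<open>g\<close>, \<open>h\<close> on \<open>S\<close>. Potentials that
  are merely \<open>C\<^sup>2\<close> do not in general admit a \<open>C\<^sup>\<infinity>\<close> curve; the curve has two more derivatives
  than the potentials. In particular it is \<open>C\<^sup>4\<close> for \<open>C\<^sup>2\<close> potentials, and \<open>C\<^sup>\<infinity>\<close> for \<open>C\<^sup>\<infinity>\<close> ones
  (the interval does not depend on \<open>k\<close>).\<close>

definition smooth_relative_to ::
    "real set \<Rightarrow> (real \<Rightarrow> real) \<Rightarrow> (real \<Rightarrow> real) \<Rightarrow> real \<Rightarrow> (real \<Rightarrow> real) \<Rightarrow> bool" where
  "smooth_relative_to S g h r s \<longleftrightarrow>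
     (\<forall>k. Ck_on k S g \<and> Ck_on k S h \<longrightarrow> Ck_on (k + 2) {-r<..<r} s)"

end

theory Submission
  imports Defs
begin

text \<open>The eigenvalue problem is reduced to the zeros of a determinant. Let \<open>(u\<^sub>1, v\<^sub>1)\<close> and \<open>(u\<^sub>2, v\<^sub>2)\<close> be the
solutions of \<open>u'' + g u = - z v\<close>, \<open>v'' + h v = z u\<close> that vanish at \<open>0\<close> and have the slopes \<open>(1, 0)\<close> and
\<open>(0, 1)\<close> there. A solution vanishes at both ends of \<open>[0, X]\<close> if and only if it is a combination of these
two that vanishes at \<open>X\<close>, so \<open>z\<close> is an eigenvalue as soon as \<open>\<Delta> (X, z) = u\<^sub>1 v\<^sub>2 - u\<^sub>2 v\<^sub>1\<close> is zero at
\<open>(X, z)\<close> (\<open>dirichlet_eigenvalue_if_singular\<close>).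

At \<open>z = 0\<close> the system decouples and \<open>\<Delta> (x, 0) = a x * b x\<close>, where \<open>a\<close> and \<open>b\<close> are the solutions of
\<open>a'' + g a = 0\<close> and \<open>b'' + h b = 0\<close> with value \<open>0\<close> and slope \<open>1\<close> at \<open>0\<close>. The kernel of \<open>N\<close> is the product
of the kernels of \<open>L\<^sub>+\<close> and \<open>L\<^sub>-\<close>, which are spanned by \<open>a\<close> and \<open>b\<close> if these vanish at \<open>l\<close> and trivial otherwise; it
is a line only if exactly one of \<open>a l\<close>, \<open>b l\<close> is zero (\<open>opN_simple_kernel\<close>). The map \<open>(u, v) \<mapsto> (v, -u)\<close> exchanges
\<open>g\<close> and \<open>h\<close> and preserves \<open>z\<close> (\<open>dirichlet_eigenvalue_swap\<close>), so assume \<open>b l = 0\<close>. Then the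
\<open>x\<close>-derivative of \<open>\<Delta>\<close> at \<open>(l, 0)\<close> is \<open>a l * b' l \<noteq> 0\<close>, and the implicit function theorem gives a curve
\<open>X\<close> with \<open>X 0 = l\<close>, \<open>\<Delta> (X z, z) = 0\<close> and \<open>X' = - \<Delta>z / \<Delta>x\<close>. The required function is \<open>s = X / l\<close>.

For the regularity, the solutions are expanded in powers of \<open>z\<close>. The coefficients come from a recursion
of inhomogeneous linear equations and are bounded geometrically (\<open>coupled_families_exist\<close>), and the
resulting series and all their \<open>z\<close>-derivatives satisfy a closed system of chain rules along the curve.
From \<open>X' = - \<Delta>z / \<Delta>x\<close> the curve therefore inherits two derivatives more than \<open>g\<close> and \<open>h\<close> have
(\<open>coupled_families_Ck_along\<close>, \<open>eigenvalue_curve\<close>).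

The concavity is computed from the expansion. As \<open>u\<^sub>2\<close> and \<open>v\<^sub>1\<close> vanish at \<open>z = 0\<close>, so do the
first-order terms of \<open>u\<^sub>1\<close> and \<open>v\<^sub>2\<close>; hence \<open>\<Delta>z (l, 0) = 0\<close> and \<open>X'' 0 = - \<Delta>zz / \<Delta>x = - 2 (a t - k p) / (a b')\<close> at \<open>l\<close>, where
\<open>p'' + h p = a\<close>, \<open>k'' + g k = - b\<close>, \<open>t'' + h t = k\<close> with zero initial data. Lagrange's identity against
\<open>b\<close> turns the values of \<open>p\<close> and \<open>t\<close> at \<open>l\<close> into inner products, and these combine into the inner product
of the kernel element with its preimage (\<open>kernel_pairing\<close>).

Finally the operators in \<open>L\<^sup>2\<close> are matched with classical boundary value problems: \<open>(f, w)\<close> with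
continuous \<open>w\<close> belongs to the graph of the Schroedinger operator if and only if \<open>f\<close> is a classical solution
with zero boundary values (\<open>schrodinger_imp_classical\<close>, \<open>classical_imp_schrodinger\<close>).\<close>

section \<open>Functions of class \<open>C\<^sup>k\<close>\<close>

lemma Ck_on_imp_continuous: "Ck_on k S f \<Longrightarrow> continuous_on S f"
  by (cases k) (auto intro: DERIV_continuous_on)

lemma Ck_on_SucD: "Ck_on (Suc k) S f \<Longrightarrow> Ck_on k S f"
proof (induction k arbitrary: f)
  case 0
  then show ?case using Ck_on_imp_continuous by fastforce
next
  case (Suc k)
  then show ?case by (metis Ck_on.simps(2))
qed

lemma Ck_on_mono: "Ck_on k S f \<Longrightarrow> j \<le> k \<Longrightarrow> Ck_on j S f"
  by (induction k) (auto simp: le_Suc_eq dest: Ck_on_SucD simp del: Ck_on.simps)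

lemma Ck_on_SucI:
  "(\<And>x. x \<in> S \<Longrightarrow> (f has_real_derivative f' x) (at x within S)) \<Longrightarrow> Ck_on k S f' \<Longrightarrow> Ck_on (Suc k) S f"
  by auto

lemma Ck_on_SucE:
  assumes "Ck_on (Suc k) S f"
  obtains f' where "\<And>x. x \<in> S \<Longrightarrow> (f has_real_derivative f' x) (at x within S)" "Ck_on k S f'"
  using assms by auto

lemma Ck_on_cong:
  assumes "Ck_on k S f" "\<And>x. x \<in> S \<Longrightarrow> f x = g x"
  shows "Ck_on k S g"
proof (cases k)
  case 0
  then show ?thesis using assms by (simp cong: continuous_on_cong)
next
  case (Suc n)
  obtain f' where f': "\<And>x. x \<in> S \<Longrightarrow> (f has_real_derivative f' x) (at x within S)" "Ck_on n S f'"
    using assms(1) Suc by (auto elim: Ck_on_SucE)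
  have "(g has_real_derivative f' x) (at x within S)" if "x \<in> S" for x
    by (rule has_field_derivative_transform_within[OF f'(1)[OF that] zero_less_one that])
       (use assms(2) in auto)
  then show ?thesis using f'(2) Suc by (auto intro: Ck_on_SucI)
qed

lemma Ck_on_const: "Ck_on k S (\<lambda>x. c)"
  by (induction k arbitrary: c) (auto intro!: Ck_on_SucI derivative_eq_intros simp del: Ck_on.simps(2))

lemma Ck_on_id: "Ck_on k S (\<lambda>x. x)"
  by (cases k) (auto intro!: Ck_on_SucI[where f'="\<lambda>_. 1"] Ck_on_const derivative_eq_intros simp del: Ck_on.simps(2))

lemma Ck_on_add: "Ck_on k S f \<Longrightarrow> Ck_on k S g \<Longrightarrow> Ck_on k S (\<lambda>x. f x + g x)"
proof (induction k arbitrary: f g)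
  case (Suc k)
  obtain f' where f':
    "\<And>x. x \<in> S \<Longrightarrow> (f has_real_derivative f' x) (at x within S)" "Ck_on k S f'"
    using Suc.prems(1) unfolding Ck_on.simps by blast
  obtain g' where g':
    "\<And>x. x \<in> S \<Longrightarrow> (g has_real_derivative g' x) (at x within S)" "Ck_on k S g'"
    using Suc.prems(2) unfolding Ck_on.simps by blast
  from f' g' show ?case
    by (intro Ck_on_SucI[where f'="\<lambda>x. f' x + g' x"] Suc.IH DERIV_add)
qed (auto intro: continuous_intros)

lemma Ck_on_mult: "Ck_on k S f \<Longrightarrow> Ck_on k S g \<Longrightarrow> Ck_on k S (\<lambda>x. f x * g x)"
proof (induction k arbitrary: f g)
  case (Suc k)
  obtain f' where f':
    "\<And>x. x \<in> S \<Longrightarrow> (f has_real_derivative f' x) (at x within S)" "Ck_on k S f'"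
    using Suc.prems(1) unfolding Ck_on.simps by blast
  obtain g' where g':
    "\<And>x. x \<in> S \<Longrightarrow> (g has_real_derivative g' x) (at x within S)" "Ck_on k S g'"
    using Suc.prems(2) unfolding Ck_on.simps by blast
  from f' g' show ?case
    by (intro Ck_on_SucI[where f'="\<lambda>x. f' x * g x + g' x * f x"] Ck_on_add Suc.IH DERIV_mult
          Ck_on_SucD[OF Suc.prems(1)] Ck_on_SucD[OF Suc.prems(2)])
qed (auto intro: continuous_intros)

lemma Ck_on_minus: "Ck_on k S f \<Longrightarrow> Ck_on k S (\<lambda>x. - f x)"
  using Ck_on_mult[OF Ck_on_const[of k S "-1"]] by simp

lemma Ck_on_diff: "Ck_on k S f \<Longrightarrow> Ck_on k S g \<Longrightarrow> Ck_on k S (\<lambda>x. f x - g x)"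
  using Ck_on_add[OF _ Ck_on_minus] by simp

lemma Ck_on_inverse:
  "Ck_on k S f \<Longrightarrow> (\<And>x. x \<in> S \<Longrightarrow> f x \<noteq> 0) \<Longrightarrow> Ck_on k S (\<lambda>x. inverse (f x))"
proof (induction k)
  case (Suc k)
  obtain f' where f':
    "\<And>x. x \<in> S \<Longrightarrow> (f has_real_derivative f' x) (at x within S)" "Ck_on k S f'"
    using Suc.prems(1) unfolding Ck_on.simps by blast
  have "Ck_on k S (\<lambda>x. inverse (f x))"
    by (intro Suc.IH Ck_on_SucD[OF Suc.prems(1)] Suc.prems(2))
  then have "Ck_on k S (\<lambda>x. - (inverse (f x) * f' x * inverse (f x)))"
    by (intro Ck_on_minus Ck_on_mult f'(2))
  moreover have "((\<lambda>x. inverse (f x)) has_real_derivative - (inverse (f x) * f' x * inverse (f x)))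
      (at x within S)" if "x \<in> S" for x
    by (rule DERIV_inverse'[OF f'(1)[OF that] Suc.prems(2)[OF that]])
  ultimately show ?case by (rule Ck_on_SucI[rotated])
qed (auto intro: continuous_intros)

lemma Ck_on_divide:
  "Ck_on k S f \<Longrightarrow> Ck_on k S g \<Longrightarrow> (\<And>x. x \<in> S \<Longrightarrow> g x \<noteq> 0) \<Longrightarrow> Ck_on k S (\<lambda>x. f x / g x)"
  unfolding divide_inverse by (intro Ck_on_mult Ck_on_inverse)

lemma Ck_on_compose:
  "Ck_on k S f \<Longrightarrow> Ck_on k T X \<Longrightarrow> X ` T \<subseteq> S \<Longrightarrow> Ck_on k T (\<lambda>t. f (X t))"
proof (induction k arbitrary: f)
  case 0
  then show ?case by (auto intro: continuous_on_compose2)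
next
  case (Suc k)
  obtain f' where f':
    "\<And>x. x \<in> S \<Longrightarrow> (f has_real_derivative f' x) (at x within S)" "Ck_on k S f'"
    using Suc.prems(1) unfolding Ck_on.simps by blast
  obtain X' where X':
    "\<And>t. t \<in> T \<Longrightarrow> (X has_real_derivative X' t) (at t within T)" "Ck_on k T X'"
    using Suc.prems(2) unfolding Ck_on.simps by blast
  have "((\<lambda>t. f (X t)) has_real_derivative f' (X t) * X' t) (at t within T)" if "t \<in> T" for t
  proof -
    have "(f has_real_derivative f' (X t)) (at (X t) within X ` T)"
      using f'(1)[of "X t"] Suc.prems(3) that by (blast intro: has_field_derivative_subset)
    from DERIV_image_chain[OF this X'(1)[OF that]] show ?thesis by (simp add: o_def)
  qed
  moreover have "Ck_on k T (\<lambda>t. f' (X t) * X' t)"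
    by (rule Ck_on_mult[OF Suc.IH[OF f'(2) Ck_on_SucD[OF Suc.prems(2)] Suc.prems(3)] X'(2)])
  ultimately show ?case by (rule Ck_on_SucI)
qed

section \<open>Linear equations of second order\<close>

lemma has_derivative_within_imp_integral:
  fixes f :: "real \<Rightarrow> real"
  assumes "\<And>x. x \<in> {0..L} \<Longrightarrow> (f has_real_derivative f' x) (at x within {0..L})" "X \<in> {0..L}"
  shows "(f' has_integral f X - f 0) {0..X}"
proof (rule fundamental_theorem_of_calculus)
  show "0 \<le> X" using assms(2) by simp
  fix x assume "x \<in> {0..X}"
  then show "(f has_vector_derivative f' x) (at x within {0..X})"
    using has_field_derivative_subset[OF assms(1), of x "{0..X}"] assms(2)
    by (auto simp flip: has_real_derivative_iff_has_vector_derivative)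
qed

lemma has_real_derivative_unique_Icc:
  assumes "(f has_real_derivative D) (at x within {a..b})" "(f has_real_derivative E) (at x within {a..b})"
    and "a < b" "x \<in> {a..b}"
  shows "D = E"
  using vector_derivative_within_closed_interval[OF assms(3,4)] assms(1,2)
  unfolding has_real_derivative_iff_has_vector_derivative by metis

lemma continuous_on_Icc_bounded:
  fixes f :: "real \<Rightarrow> real"
  assumes "continuous_on {a..b} f"
  shows "\<exists>B. \<forall>x\<in>{a..b}. \<bar>f x\<bar> \<le> B"
  using compact_imp_bounded[OF compact_continuous_image[OF assms compact_Icc]]
  unfolding bounded_iff by auto

lemma abs_le_of_derivative_bound:
  fixes F G f g :: "real \<Rightarrow> real"
  assumes F: "\<And>t. t \<in> {0..L} \<Longrightarrow> (F has_real_derivative f t) (at t within {0..L})"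
    and G: "\<And>t. t \<in> {0..L} \<Longrightarrow> (G has_real_derivative g t) (at t within {0..L})"
    and le: "\<And>t. t \<in> {0..L} \<Longrightarrow> \<bar>f t\<bar> \<le> g t"
    and zero: "F 0 = 0" "G 0 = 0" and x: "x \<in> {0..L}"
  shows "\<bar>F x\<bar> \<le> G x"
proof -
  have int: "(f has_integral F x) {0..x}" "(g has_integral G x) {0..x}"
    using has_derivative_within_imp_integral[OF F x] has_derivative_within_imp_integral[OF G x] zero
    by auto
  have "F x \<le> G x"
    by (rule has_integral_le[OF int]) (use le x in force)
  moreover have "- F x \<le> G x"
    by (rule has_integral_le[OF has_integral_neg[OF int(1)] int(2)]) (use le x in force)
  ultimately show ?thesis by simp
qed

lemma series_has_derivative_within:
  fixes F f :: "nat \<Rightarrow> real \<Rightarrow> real"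
  assumes "convex S"
    and der: "\<And>n x. x \<in> S \<Longrightarrow> (F n has_real_derivative f n x) (at x within S)"
    and F: "\<And>n x. x \<in> S \<Longrightarrow> \<bar>F n x\<bar> \<le> M n"
    and f: "\<And>n x. x \<in> S \<Longrightarrow> \<bar>f n x\<bar> \<le> M n"
    and M: "summable M" and x: "x \<in> S"
  shows "((\<lambda>x. \<Sum>n. F n x) has_real_derivative (\<Sum>n. f n x)) (at x within S)"
proof -
  have "uniform_limit S (\<lambda>n x. \<Sum>i<n. f i x) (\<lambda>x. \<Sum>i. f i x) sequentially"
    using f M by (intro Weierstrass_m_test[where M=M]) auto
  moreover have "summable (\<lambda>n. F n x)"
    using F[OF x] by (intro summable_comparison_test'[OF M, of 0]) auto
  ultimately obtain G where "\<forall>x\<in>S. (\<lambda>n. F n x) sums G x \<and>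
       (G has_real_derivative (\<Sum>n. f n x)) (at x within S)"
    using has_field_derivative_series[of S F f, OF assms(1) der _ x] by blast
  then have "(G has_real_derivative (\<Sum>n. f n x)) (at x within S)"
      "\<And>y. y \<in> S \<Longrightarrow> G y = (\<Sum>n. F n y)"
    using x by (auto simp: sums_iff)
  then show ?thesis
    by (rule has_field_derivative_transform_within[OF _ zero_less_one x])
qed

text \<open>The equation \<open>y'' + q y = f\<close> on \<open>[0,L]\<close>, with \<open>y1\<close> in the role of \<open>y'\<close>.\<close>

definition ode_solution ::
    "real \<Rightarrow> (real \<Rightarrow> real) \<Rightarrow> (real \<Rightarrow> real) \<Rightarrow> (real \<Rightarrow> real) \<Rightarrow> (real \<Rightarrow> real) \<Rightarrow> bool" where
  "ode_solution L q f y y1 \<longleftrightarrow>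
     (\<forall>x\<in>{0..L}. (y has_real_derivative y1 x) (at x within {0..L}) \<and>
                 (y1 has_real_derivative f x - q x * y x) (at x within {0..L}))"

text \<open>Existence by Picard iteration. The constant depends on \<open>q\<close> only, not on the right-hand side: this is what
allows a recursion of such equations to be bounded geometrically.\<close>

lemma ode_solution_exists_bounded:
  fixes q :: "real \<Rightarrow> real"
  assumes q: "continuous_on {0..L} q" and L: "0 \<le> L"
  shows "\<exists>K\<ge>0. \<forall>f. continuous_on {0..L} f \<longrightarrow>
    (\<exists>y y1. ode_solution L q f y y1 \<and> y 0 = 0 \<and> y1 0 = 0 \<and>
       (\<forall>B. (\<forall>x\<in>{0..L}. \<bar>f x\<bar> \<le> B) \<longrightarrow>
            (\<forall>x\<in>{0..L}. \<bar>y x\<bar> \<le> K * B \<and> \<bar>y1 x\<bar> \<le> K * B)))"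
proof -
  obtain Q where Q: "0 < Q" "\<And>x. x \<in> {0..L} \<Longrightarrow> \<bar>q x\<bar> \<le> Q"
    using compact_imp_bounded[OF compact_continuous_image[OF q compact_Icc]]
    unfolding bounded_pos by auto
  \<comment> \<open>Each step multiplies by \<open>q\<close> and integrates twice; the factor \<open>n!\<close> comes from one of the two
  integrations, the other one is estimated by the length of the interval.\<close>
  define c where "c = Q * (L + 1)"
  define m where "m n = (c * L) ^ n / fact n" for n :: nat
  have c: "0 \<le> c" using Q L by (simp add: c_def)
  have m: "summable m" "\<And>n. 0 \<le> m n"
    unfolding m_def using summable_exp[of "c * L"] c L by (auto simp: field_simps)
  define K where "K = (L + 1) ^ 2 * (\<Sum>n. m n)"
  have K: "0 \<le> K" using m by (auto simp: K_def suminf_nonneg)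
  show ?thesis
  proof (intro exI[of _ K] conjI allI impI K)
    fix f :: "real \<Rightarrow> real" assume f: "continuous_on {0..L} f"
    define I where "I w x = integral {0..x} w" for w :: "real \<Rightarrow> real" and x
    \<comment> \<open>The Picard series is written for \<open>y''\<close>: its terms are \<open>p\<^sub>0 = f\<close>, \<open>p\<^sub>n\<^sub>+\<^sub>1 = - q I(I p\<^sub>n)\<close>, and \<open>y = \<Sum>n. I(I p\<^sub>n)\<close>.\<close>
    define p where "p n = ((\<lambda>w x. - (q x * I (I w) x)) ^^ n) f" for n
    have p0: "p 0 = f" and pS: "p (Suc n) x = - (q x * I (I (p n)) x)" for n x
      by (auto simp: p_def)
    have Ider: "(I w has_real_derivative w x) (at x within {0..L})"
      if "continuous_on {0..L} w" "x \<in> {0..L}" for w x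
      unfolding I_def using integral_has_real_derivative[OF that] .
    have Icont: "continuous_on {0..L} (I w)" if "continuous_on {0..L} w" for w
      by (rule DERIV_continuous_on) (rule Ider[OF that])
    have pcont: "continuous_on {0..L} (p n)" for n
    proof (induction n)
      case (Suc n)
      have "p (Suc n) = (\<lambda>x. - (q x * I (I (p n)) x))" using pS by auto
      then show ?case using Suc q Icont by (auto intro!: continuous_intros)
    qed (simp add: p0 f)
    have I0: "I w 0 = 0" for w by (simp add: I_def)
    have bound: "\<bar>p n x\<bar> \<le> B * (c * x) ^ n / fact n" "\<bar>I (p n) x\<bar> \<le> (L + 1) * (B * m n)"
        "\<bar>I (I (p n)) x\<bar> \<le> (L + 1)\<^sup>2 * (B * m n)" "\<bar>p n x\<bar> \<le> B * m n"
      if B: "\<forall>x\<in>{0..L}. \<bar>f x\<bar> \<le> B" and x: "x \<in> {0..L}" for B n x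
    proof -
      have "0 \<le> \<bar>f 0\<bar>" by simp
      also have "\<dots> \<le> B" using B L by auto
      finally have B0: "0 \<le> B" .
      have step: "\<bar>I (p n) x\<bar> \<le> B * c ^ n * x ^ Suc n / fact (Suc n)"
        if "\<forall>x\<in>{0..L}. \<bar>p n x\<bar> \<le> B * (c * x) ^ n / fact n" "x \<in> {0..L}" for n x
      proof (rule abs_le_of_derivative_bound[OF Ider[OF pcont] _ _ I0 _ that(2)])
        fix t assume t: "t \<in> {0..L}"
        have "((\<lambda>x. B * c ^ n * x ^ Suc n / fact (Suc n)) has_real_derivative
               B * c ^ n * (real (Suc n) * t ^ n) / fact (Suc n)) (at t within {0..L})"
          by (rule derivative_eq_intros refl | simp)+
        then show "((\<lambda>x. B * c ^ n * x ^ Suc n / fact (Suc n)) has_real_derivative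
               B * (c * t) ^ n / fact n) (at t within {0..L})"
          by (simp add: power_mult_distrib field_simps del: of_nat_Suc power_Suc)
      qed (use that in auto)
      have step2: "\<bar>I (I (p n)) x\<bar> \<le> B * c ^ n * x ^ Suc n / fact (Suc n) * L"
        if "\<forall>x\<in>{0..L}. \<bar>p n x\<bar> \<le> B * (c * x) ^ n / fact n" "x \<in> {0..L}" for n x
      proof -
        have "\<bar>I (I (p n)) x\<bar> \<le> B * c ^ n * x ^ Suc n / fact (Suc n) * x"
        proof (rule abs_le_of_derivative_bound[where L=x and F="I (I (p n))" and f="I (p n)"
                and g="\<lambda>_. B * c ^ n * x ^ Suc n / fact (Suc n)"
                and G="\<lambda>t. B * c ^ n * x ^ Suc n / fact (Suc n) * t"])
          fix t assume t: "t \<in> {0..x}"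
          show "(I (I (p n)) has_real_derivative I (p n) t) (at t within {0..x})"
            by (rule has_field_derivative_subset[OF Ider[OF Icont[OF pcont]]]) (use t that in auto)
          have "\<bar>I (p n) t\<bar> \<le> B * c ^ n * t ^ Suc n / fact (Suc n)"
            using step[OF that(1), of t] t that(2) by auto
          also have "\<dots> \<le> B * c ^ n * x ^ Suc n / fact (Suc n)"
            using t B0 c by (intro divide_right_mono mult_left_mono power_mono) auto
          finally show "\<bar>I (p n) t\<bar> \<le> B * c ^ n * x ^ Suc n / fact (Suc n)" .
          show "((\<lambda>t. B * c ^ n * x ^ Suc n / fact (Suc n) * t) has_real_derivative
                B * c ^ n * x ^ Suc n / fact (Suc n)) (at t within {0..x})"
            by (rule derivative_eq_intros refl | simp)+
        qed (use that I0 in auto)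
        also have "\<dots> \<le> B * c ^ n * x ^ Suc n / fact (Suc n) * L"
          using that B0 c by (intro mult_left_mono) auto
        finally show ?thesis .
      qed
      have ind: "\<forall>x\<in>{0..L}. \<bar>p n x\<bar> \<le> B * (c * x) ^ n / fact n" for n
      proof (induction n)
        case 0
        then show ?case using B by (simp add: p0)
      next
        case (Suc n)
        show ?case
        proof
          fix x assume x: "x \<in> {0..L}"
          have "\<bar>p (Suc n) x\<bar> = \<bar>q x\<bar> * \<bar>I (I (p n)) x\<bar>" by (simp add: pS abs_mult)
          also have "\<dots> \<le> Q * (B * c ^ n * x ^ Suc n / fact (Suc n) * L)"
            using Q x by (intro mult_mono step2[OF Suc]) auto
          also have "\<dots> \<le> Q * (B * c ^ n * x ^ Suc n / fact (Suc n) * (L + 1))"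
            using Q x B0 c by (intro mult_left_mono) auto
          also have "\<dots> = B * (c * x) ^ Suc n / fact (Suc n)"
            by (simp add: power_mult_distrib c_def mult_ac)
          finally show "\<bar>p (Suc n) x\<bar> \<le> B * (c * x) ^ Suc n / fact (Suc n)" .
        qed
      qed
      show "\<bar>p n x\<bar> \<le> B * (c * x) ^ n / fact n" using ind x by blast
      also have "\<dots> \<le> B * (c * L) ^ n / fact n"
        using x B0 c by (intro divide_right_mono mult_left_mono power_mono) auto
      finally show "\<bar>p n x\<bar> \<le> B * m n" by (simp add: m_def)
      have "B * c ^ n * x ^ Suc n / fact (Suc n) \<le> B * c ^ n * L ^ Suc n / fact n"
        using x B0 c by (intro frac_le mult_left_mono power_mono fact_mono) auto
      also have "\<dots> = L * (B * m n)" by (simp add: m_def power_mult_distrib)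
      finally have pow: "B * c ^ n * x ^ Suc n / fact (Suc n) \<le> L * (B * m n)" .
      have Bm: "0 \<le> B * m n" using B0 m by simp
      show "\<bar>I (p n) x\<bar> \<le> (L + 1) * (B * m n)"
        using step[OF ind x, of n] pow Bm by (simp add: algebra_simps)
      have "\<bar>I (I (p n)) x\<bar> \<le> L * (B * m n) * L"
        using step2[OF ind x, of n] mult_right_mono[OF pow L] by linarith
      also have "\<dots> \<le> (L + 1)\<^sup>2 * (B * m n)"
        using Bm L mult_nonneg_nonneg[OF L Bm] by (simp add: power2_eq_square algebra_simps)
      finally show "\<bar>I (I (p n)) x\<bar> \<le> (L + 1)\<^sup>2 * (B * m n)" .
    qed
    obtain B0 where B0: "0 < B0" "\<forall>x\<in>{0..L}. \<bar>f x\<bar> \<le> B0"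
      using compact_imp_bounded[OF compact_continuous_image[OF f compact_Icc]]
      unfolding bounded_pos by auto
    define M where "M n = (L + 1)\<^sup>2 * (B0 * m n)" for n
    have M: "summable M" unfolding M_def by (intro summable_mult m)
    have "(L + 1) * (B0 * m n) \<le> M n" "B0 * m n \<le> M n" for n
    proof -
      have "0 \<le> B0 * m n" using B0 m by simp
      moreover have "L + 1 \<le> (L + 1)\<^sup>2" "1 \<le> (L + 1)\<^sup>2"
        using L by (auto simp: power2_eq_square algebra_simps)
      ultimately show "(L + 1) * (B0 * m n) \<le> M n" "B0 * m n \<le> M n"
        unfolding M_def using mult_right_mono by (blast, fastforce)
    qed
    then have le: "\<bar>I (I (p n)) x\<bar> \<le> M n" "\<bar>I (p n) x\<bar> \<le> M n" "\<bar>p n x\<bar> \<le> M n"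
      if "x \<in> {0..L}" for n x
      using bound[OF B0(2) that, of n] unfolding M_def by (auto intro: order_trans)
    define y where "y x = (\<Sum>n. I (I (p n)) x)" for x
    define y1 where "y1 x = (\<Sum>n. I (p n) x)" for x
    have "ode_solution L q f y y1"
      unfolding ode_solution_def
    proof (intro ballI conjI)
      fix x assume x: "x \<in> {0..L}"
      show "(y has_real_derivative y1 x) (at x within {0..L})"
        unfolding y_def[abs_def] y1_def
        by (rule series_has_derivative_within[where M=M])
           (use le x Ider[OF Icont[OF pcont]] M in auto)
      have "(y1 has_real_derivative (\<Sum>n. p n x)) (at x within {0..L})"
        unfolding y1_def[abs_def]
        by (rule series_has_derivative_within[where M=M])
           (use le x Ider[OF pcont] M in auto)
      moreover have "(\<Sum>n. p n x) = f x - q x * y x"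
      proof -
        have s: "summable (\<lambda>n. p n x)" "summable (\<lambda>n. I (I (p n)) x)"
          using le[OF x] by (auto intro!: summable_comparison_test'[OF M, of 0])
        have "(\<Sum>n. p n x) = p 0 x + (\<Sum>n. p (Suc n) x)"
          using suminf_split_head[OF s(1)] by simp
        also have "(\<Sum>n. p (Suc n) x) = - (q x * y x)"
          using s(2) by (simp add: pS suminf_minus suminf_mult summable_mult y_def)
        finally show ?thesis by (simp add: p0)
      qed
      ultimately show "(y1 has_real_derivative f x - q x * y x) (at x within {0..L})" by simp
    qed
    moreover have "y 0 = 0" "y1 0 = 0" by (simp_all add: y_def y1_def I0)
    moreover have "\<bar>y x\<bar> \<le> K * B \<and> \<bar>y1 x\<bar> \<le> K * B"
      if B: "\<forall>x\<in>{0..L}. \<bar>f x\<bar> \<le> B" and x: "x \<in> {0..L}" for B x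
    proof -
      have sm: "summable (\<lambda>n. a * (B * m n))" for a by (intro summable_mult m)
      have sum: "(\<Sum>n. a * (B * m n)) = a * (B * (\<Sum>n. m n))" for a
        using m by (simp add: suminf_mult summable_mult)
      have "norm (\<Sum>n. I (I (p n)) x) \<le> (\<Sum>n. (L + 1)\<^sup>2 * (B * m n))"
        by (rule norm_suminf_le) (use bound[OF B x] sm in auto)
      then have 1: "\<bar>y x\<bar> \<le> K * B" unfolding sum by (simp add: y_def K_def mult_ac)
      have "norm (\<Sum>n. I (p n) x) \<le> (\<Sum>n. (L + 1) * (B * m n))"
        by (rule norm_suminf_le) (use bound[OF B x] sm in auto)
      also have "\<dots> \<le> (L + 1)\<^sup>2 * (B * (\<Sum>n. m n))"
      proof -
        have "0 \<le> B" using B x by force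
        then have "0 \<le> B * (\<Sum>n. m n)" using m by (simp add: suminf_nonneg)
        moreover have "L + 1 \<le> (L + 1)\<^sup>2"
          using L by (auto simp: power2_eq_square algebra_simps)
        ultimately show ?thesis unfolding sum by (intro mult_right_mono)
      qed
      finally have 2: "\<bar>y1 x\<bar> \<le> K * B" by (simp add: y1_def K_def mult_ac)
      from 1 2 show ?thesis by simp
    qed
    ultimately show "\<exists>y y1. ode_solution L q f y y1 \<and> y 0 = 0 \<and> y1 0 = 0 \<and>
       (\<forall>B. (\<forall>x\<in>{0..L}. \<bar>f x\<bar> \<le> B) \<longrightarrow>
            (\<forall>x\<in>{0..L}. \<bar>y x\<bar> \<le> K * B \<and> \<bar>y1 x\<bar> \<le> K * B))"
      by blast
  qed
qed

lemma ode_solution_diff: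
  assumes "ode_solution L q f y y1" "ode_solution L q k w w1"
  shows "ode_solution L q (\<lambda>x. f x - a * k x) (\<lambda>x. y x - a * w x) (\<lambda>x. y1 x - a * w1 x)"
  using assms unfolding ode_solution_def
  by (auto intro!: derivative_eq_intros simp: algebra_simps)

lemma ode_solution_restrict:
  "ode_solution L q f y y1 \<Longrightarrow> l \<le> L \<Longrightarrow> ode_solution l q f y y1"
  unfolding ode_solution_def
  by (auto intro!: has_field_derivative_subset[where s="{0..L}" and t="{0..l}"])

lemma ode_solution_cong_rhs:
  "ode_solution L q f y y1 \<Longrightarrow> (\<And>x. x \<in> {0..L} \<Longrightarrow> f x = k x) \<Longrightarrow> ode_solution L q k y y1"
  unfolding ode_solution_def by auto

lemma ode_solution_continuous:
  assumes "ode_solution L q f y y1"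
  shows "continuous_on {0..L} y" "continuous_on {0..L} y1"
proof -
  have *: "(y has_real_derivative y1 x) (at x within {0..L})"
    "(y1 has_real_derivative f x - q x * y x) (at x within {0..L})" if "x \<in> {0..L}" for x
    using assms that unfolding ode_solution_def by auto
  show "continuous_on {0..L} y" "continuous_on {0..L} y1"
    by (rule DERIV_continuous_on[OF *(1)] DERIV_continuous_on[OF *(2)]; assumption)+
qed

text \<open>Subtracting the affine function with the prescribed initial data leaves a problem with zero initial data.\<close>

lemma ode_solution_exists:
  assumes q: "continuous_on {0..L} q" and L: "0 \<le> L" and f: "continuous_on {0..L} f"
  obtains y y1 where "ode_solution L q f y y1" "y 0 = a" "y1 0 = b"
proof -
  have "continuous_on {0..L} (\<lambda>x. f x - q x * (a + b * x))"
    by (intro continuous_intros q f)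
  then obtain y y1 where y: "ode_solution L q (\<lambda>x. f x - q x * (a + b * x)) y y1" "y 0 = 0" "y1 0 = 0"
    using ode_solution_exists_bounded[OF q L] by blast
  show thesis
  proof
    show "ode_solution L q f (\<lambda>x. a + b * x + y x) (\<lambda>x. b + y1 x)"
      using y(1) unfolding ode_solution_def
      by (auto intro!: derivative_eq_intros simp: algebra_simps)
  qed (use y in auto)
qed

text \<open>The potential cancels in the derivative of \<open>y1 w - y w1\<close>. For equal homogeneous equations this says that the
Wronskian is constant; in general it expresses inner products by boundary values.\<close>

lemma lagrange_identity:
  assumes "ode_solution L q f y y1" "ode_solution L q k w w1" "X \<in> {0..L}"
  shows "((\<lambda>x. f x * w x - y x * k x) has_integral
           (y1 X * w X - y X * w1 X) - (y1 0 * w 0 - y 0 * w1 0)) {0..X}"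
proof (rule has_derivative_within_imp_integral[OF _ assms(3)])
  fix x assume "x \<in> {0..L}"
  then show "((\<lambda>x. y1 x * w x - y x * w1 x) has_real_derivative f x * w x - y x * k x) (at x within {0..L})"
    using assms unfolding ode_solution_def
    by (auto intro!: derivative_eq_intros simp: algebra_simps)
qed

lemma wronskian_constant:
  assumes "ode_solution L q (\<lambda>_. 0) y y1" "ode_solution L q (\<lambda>_. 0) w w1" "X \<in> {0..L}"
  shows "y1 X * w X - y X * w1 X = y1 0 * w 0 - y 0 * w1 0"
  using lagrange_identity[OF assms] by (simp add: has_integral_iff)

lemma ode_solution_homogeneous_zero:
  assumes q: "continuous_on {0..L} q" and y: "ode_solution L q (\<lambda>_. 0) y y1" "y 0 = 0" "y1 0 = 0"
    and x: "x \<in> {0..L}"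
  shows "y x = 0" "y1 x = 0"
proof -
  have L: "0 \<le> L" using x by auto
  \<comment> \<open>The vector \<open>(y, y1)\<close> has zero Wronskian with two solutions whose own Wronskian is \<open>1\<close>.\<close>
  obtain u u1 where u: "ode_solution L q (\<lambda>_. 0) u u1" "u 0 = 1" "u1 0 = 0"
    by (rule ode_solution_exists[OF q L continuous_on_const])
  obtain v v1 where v: "ode_solution L q (\<lambda>_. 0) v v1" "v 0 = 0" "v1 0 = 1"
    by (rule ode_solution_exists[OF q L continuous_on_const])
  have 1: "y1 x * u x - y x * u1 x = 0" "y1 x * v x - y x * v1 x = 0" "v1 x * u x - v x * u1 x = 1"
    using wronskian_constant[OF y(1) u(1) x] wronskian_constant[OF y(1) v(1) x]
      wronskian_constant[OF v(1) u(1) x] y u v by auto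
  have "y x = y x * (v1 x * u x - v x * u1 x)" using 1 by simp
  also have "\<dots> = (y1 x * u x - y x * u1 x) * v x - (y1 x * v x - y x * v1 x) * u x - 0"
    by (simp add: algebra_simps)
  finally show "y x = 0" using 1 by simp
  have "y1 x = y1 x * (v1 x * u x - v x * u1 x)" using 1 by simp
  also have "\<dots> = (y1 x * u x - y x * u1 x) * v1 x - (y1 x * v x - y x * v1 x) * u1 x"
    by (simp add: algebra_simps)
  finally show "y1 x = 0" using 1 by simp
qed

lemma ode_solution_multiple:
  assumes q: "continuous_on {0..L} q"
    and y: "ode_solution L q (\<lambda>_. 0) y y1" "y 0 = 0"
    and w: "ode_solution L q (\<lambda>_. 0) w w1" "w 0 = 0" "w1 0 = 1"
    and x: "x \<in> {0..L}"
  shows "y x = y1 0 * w x" "y1 x = y1 0 * w1 x"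
  using ode_solution_homogeneous_zero[OF q, of "\<lambda>x. y x - y1 0 * w x" "\<lambda>x. y1 x - y1 0 * w1 x" x]
    ode_solution_diff[OF y(1) w(1), of "y1 0"] y(2) w(2,3) x by auto

text \<open>The Wronskian with a solution that equals \<open>1\<close> at \<open>0\<close> vanishes at \<open>L\<close>, so the slope at \<open>0\<close> is zero, too. In
particular the derivative of a Dirichlet eigenfunction at the right end is nonzero.\<close>

lemma ode_solution_double_zero:
  assumes q: "continuous_on {0..L} q"
    and y: "ode_solution L q (\<lambda>_. 0) y y1" "y 0 = 0" "y L = 0" "y1 L = 0"
    and x: "x \<in> {0..L}"
  shows "y x = 0"
proof -
  have L: "0 \<le> L" using x by auto
  obtain u u1 where u: "ode_solution L q (\<lambda>_. 0) u u1" "u 0 = 1" "u1 0 = 0"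
    by (rule ode_solution_exists[OF q L continuous_on_const])
  have "y1 0 = 0" using wronskian_constant[OF y(1) u(1), of L] y u L by auto
  then show ?thesis using ode_solution_homogeneous_zero(1)[OF q y(1,2) _ x] by simp
qed

section \<open>Power series with differentiable coefficients\<close>

text \<open>The power series with the coefficients \<open>c n x\<close> converges for \<open>\<bar>z\<bar> < R\<close>, uniformly in \<open>x \<in> S\<close>. The bound is
imposed at every smaller radius rather than at \<open>R\<close>, as only this survives differentiation in \<open>z\<close>.\<close>

definition geometric_on :: "real set \<Rightarrow> real \<Rightarrow> (nat \<Rightarrow> real \<Rightarrow> real) \<Rightarrow> bool" where
  "geometric_on S R c \<longleftrightarrow> (\<forall>\<rho>. 0 < \<rho> \<and> \<rho> < R \<longrightarrow> (\<exists>C. \<forall>n. \<forall>x\<in>S. \<bar>c n x\<bar> * \<rho> ^ n \<le> C))"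

definition param_series :: "(nat \<Rightarrow> real \<Rightarrow> real) \<Rightarrow> real \<Rightarrow> real \<Rightarrow> real" where
  "param_series c x z = (\<Sum>n. c n x * z ^ n)"

text \<open>The coefficients of the \<open>z\<close>-derivative.\<close>

definition diff_coeffs :: "(nat \<Rightarrow> real \<Rightarrow> real) \<Rightarrow> nat \<Rightarrow> real \<Rightarrow> real" where
  "diff_coeffs c n x = real (Suc n) * c (Suc n) x"

text \<open>The coefficients of the series multiplied by \<open>z\<close>.\<close>

definition shift_coeffs :: "(nat \<Rightarrow> real \<Rightarrow> real) \<Rightarrow> nat \<Rightarrow> real \<Rightarrow> real" where
  "shift_coeffs c n x = (case n of 0 \<Rightarrow> 0 | Suc m \<Rightarrow> c m x)"

definition differentiable_family ::
    "real set \<Rightarrow> real \<Rightarrow> (nat \<Rightarrow> real \<Rightarrow> real) \<Rightarrow> (nat \<Rightarrow> real \<Rightarrow> real) \<Rightarrow> bool" where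
  "differentiable_family S R c c1 \<longleftrightarrow> geometric_on S R c \<and> geometric_on S R c1 \<and>
     (\<forall>n. \<forall>x\<in>S. (c n has_real_derivative c1 n x) (at x within S))"

lemma param_series_0 [simp]: "param_series c x 0 = c 0 x"
  using powser_zero[of "\<lambda>n. c n x"] by (simp add: param_series_def)

lemma geometric_on_majorant:
  assumes c: "geometric_on S R c" and \<rho>: "0 < \<rho>" "\<rho> < R"
  obtains M where "summable M" "\<And>n x z. x \<in> S \<Longrightarrow> \<bar>z\<bar> \<le> \<rho> \<Longrightarrow> \<bar>c n x * z ^ n\<bar> \<le> M n"
proof -
  \<comment> \<open>The bound at a radius strictly between \<open>\<rho>\<close> and \<open>R\<close> leaves room for a geometric factor.\<close>
  define r where "r = (\<rho> + R) / 2"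
  have r: "0 < r" "\<rho> < r" "r < R" using \<rho> by (auto simp: r_def)
  obtain C where C: "\<And>n x. x \<in> S \<Longrightarrow> \<bar>c n x\<bar> * r ^ n \<le> C"
    using c r unfolding geometric_on_def by blast
  show thesis
  proof
    show "summable (\<lambda>n. C * (\<rho> / r) ^ n)"
      using r \<rho> by (intro summable_mult summable_geometric) auto
    fix n x and z :: real assume x: "x \<in> S" and z: "\<bar>z\<bar> \<le> \<rho>"
    have "\<bar>c n x * z ^ n\<bar> \<le> \<bar>c n x\<bar> * \<rho> ^ n"
      using z by (auto simp: abs_mult power_abs intro!: mult_left_mono power_mono)
    also have "\<dots> = \<bar>c n x\<bar> * r ^ n * (\<rho> / r) ^ n"
      using r by (simp add: power_divide)
    also have "\<dots> \<le> C * (\<rho> / r) ^ n"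
      using C[OF x] r \<rho> by (intro mult_right_mono) auto
    finally show "\<bar>c n x * z ^ n\<bar> \<le> C * (\<rho> / r) ^ n" .
  qed
qed

lemma geometric_on_diff_coeffs:
  assumes c: "geometric_on S R c"
  shows "geometric_on S R (diff_coeffs c)"
  unfolding geometric_on_def
proof (intro allI impI)
  fix \<rho> assume \<rho>: "0 < \<rho> \<and> \<rho> < R"
  define r where "r = (\<rho> + R) / 2"
  have r: "0 < r" "\<rho> < r" "r < R" using \<rho> by (auto simp: r_def)
  obtain C where C: "\<And>n x. x \<in> S \<Longrightarrow> \<bar>c n x\<bar> * r ^ n \<le> C"
    using c r unfolding geometric_on_def by blast
  have "(\<lambda>n. real n * (\<rho> / r) ^ n) \<longlonglongrightarrow> 0"
    using r \<rho> by (intro powser_times_n_limit_0) auto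
  from convergent_imp_Bseq[OF convergentI[OF this]]
  obtain B where B: "0 < B" "\<And>n. norm (real n * (\<rho> / r) ^ n) \<le> B"
    unfolding Bseq_def by blast
  have "\<bar>diff_coeffs c n x\<bar> * \<rho> ^ n \<le> C * B / \<rho>" if x: "x \<in> S" for n x
  proof -
    have "\<bar>c 0 x\<bar> \<le> C" using C[OF x, of 0] by simp
    then have C0: "0 \<le> C" by linarith
    have "(\<rho> / r) ^ Suc n * r ^ Suc n = (\<rho> / r * r) ^ Suc n"
      by (rule power_mult_distrib[symmetric])
    then have pow: "r ^ Suc n * (\<rho> / r) ^ Suc n = \<rho> ^ n * \<rho>"
      using r by (simp only: mult.commute power_Suc) simp
    have "\<bar>diff_coeffs c n x\<bar> * \<rho> ^ n * \<rho> = \<bar>c (Suc n) x\<bar> * real (Suc n) * (\<rho> ^ n * \<rho>)"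
      by (simp add: diff_coeffs_def abs_mult)
    also have "\<dots> = (\<bar>c (Suc n) x\<bar> * r ^ Suc n) * (real (Suc n) * (\<rho> / r) ^ Suc n)"
      unfolding pow[symmetric] by (simp only: mult_ac)
    also have "\<dots> \<le> C * B"
    proof (rule mult_mono[OF C[OF x] _ C0])
      show "real (Suc n) * (\<rho> / r) ^ Suc n \<le> B"
        using B(2)[of "Suc n"] unfolding real_norm_def by linarith
      show "0 \<le> real (Suc n) * (\<rho> / r) ^ Suc n"
        using r \<rho> by (intro mult_nonneg_nonneg zero_le_power) auto
    qed
    finally show ?thesis using \<rho> by (simp add: pos_le_divide_eq)
  qed
  then show "\<exists>C. \<forall>n. \<forall>x\<in>S. \<bar>diff_coeffs c n x\<bar> * \<rho> ^ n \<le> C" by blast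
qed

lemma geometric_on_add:
  assumes "geometric_on S R c" "geometric_on S R d"
  shows "geometric_on S R (\<lambda>n x. c n x + d n x)"
  unfolding geometric_on_def
proof (intro allI impI)
  fix \<rho> assume \<rho>: "0 < \<rho> \<and> \<rho> < R"
  obtain C where C: "\<And>n x. x \<in> S \<Longrightarrow> \<bar>c n x\<bar> * \<rho> ^ n \<le> C"
    using assms(1) \<rho> unfolding geometric_on_def by blast
  obtain D where D: "\<And>n x. x \<in> S \<Longrightarrow> \<bar>d n x\<bar> * \<rho> ^ n \<le> D"
    using assms(2) \<rho> unfolding geometric_on_def by blast
  have "\<bar>c n x + d n x\<bar> * \<rho> ^ n \<le> C + D" if "x \<in> S" for n x
  proof -
    have "\<bar>c n x + d n x\<bar> * \<rho> ^ n \<le> (\<bar>c n x\<bar> + \<bar>d n x\<bar>) * \<rho> ^ n"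
      using \<rho> by (intro mult_right_mono) auto
    also have "\<dots> \<le> C + D" using C[OF that] D[OF that] by (simp add: distrib_right add_mono)
    finally show ?thesis .
  qed
  then show "\<exists>C. \<forall>n. \<forall>x\<in>S. \<bar>c n x + d n x\<bar> * \<rho> ^ n \<le> C" by blast
qed

lemma geometric_on_mult:
  assumes "geometric_on S R c" "\<And>x. x \<in> S \<Longrightarrow> \<bar>k x\<bar> \<le> K"
  shows "geometric_on S R (\<lambda>n x. k x * c n x)"
  unfolding geometric_on_def
proof (intro allI impI)
  fix \<rho> assume \<rho>: "0 < \<rho> \<and> \<rho> < R"
  obtain C where C: "\<And>n x. x \<in> S \<Longrightarrow> \<bar>c n x\<bar> * \<rho> ^ n \<le> C"
    using assms(1) \<rho> unfolding geometric_on_def by blast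
  have "\<bar>k x * c n x\<bar> * \<rho> ^ n \<le> K * C" if "x \<in> S" for n x
  proof -
    have "\<bar>k x * c n x\<bar> * \<rho> ^ n = \<bar>k x\<bar> * (\<bar>c n x\<bar> * \<rho> ^ n)" by (simp add: abs_mult)
    also have "\<dots> \<le> K * C"
    proof (rule mult_mono[OF assms(2)[OF that] C[OF that]])
      show "0 \<le> K" using assms(2)[OF that] by linarith
      show "0 \<le> \<bar>c n x\<bar> * \<rho> ^ n" using \<rho> by simp
    qed
    finally show ?thesis .
  qed
  then show "\<exists>C. \<forall>n. \<forall>x\<in>S. \<bar>k x * c n x\<bar> * \<rho> ^ n \<le> C" by blast
qed

lemma geometric_on_shift_coeffs:
  assumes "geometric_on S R c"
  shows "geometric_on S R (shift_coeffs c)"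
  unfolding geometric_on_def
proof (intro allI impI)
  fix \<rho> assume \<rho>: "0 < \<rho> \<and> \<rho> < R"
  obtain C where C: "\<And>n x. x \<in> S \<Longrightarrow> \<bar>c n x\<bar> * \<rho> ^ n \<le> C"
    using assms(1) \<rho> unfolding geometric_on_def by blast
  have "\<bar>shift_coeffs c n x\<bar> * \<rho> ^ n \<le> \<rho> * \<bar>C\<bar>" if "x \<in> S" for n x
  proof (cases n)
    case 0
    then show ?thesis using \<rho> by (simp add: shift_coeffs_def)
  next
    case (Suc m)
    have "\<rho> * (\<bar>c m x\<bar> * \<rho> ^ m) \<le> \<rho> * \<bar>C\<bar>"
      using C[OF that, of m] \<rho> by (intro mult_left_mono) auto
    then show ?thesis by (simp add: Suc shift_coeffs_def mult_ac)
  qed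
  then show "\<exists>C. \<forall>n. \<forall>x\<in>S. \<bar>shift_coeffs c n x\<bar> * \<rho> ^ n \<le> C" by blast
qed

lemma summable_param_series:
  assumes "geometric_on S R c" "x \<in> S" "\<bar>z\<bar> < R"
  shows "summable (\<lambda>n. c n x * z ^ n)"
proof -
  define \<rho> where "\<rho> = (\<bar>z\<bar> + R) / 2"
  have \<rho>: "0 < \<rho>" "\<bar>z\<bar> < \<rho>" "\<rho> < R" using assms(3) by (auto simp: \<rho>_def)
  obtain M where "summable M" "\<And>n x z. x \<in> S \<Longrightarrow> \<bar>z\<bar> \<le> \<rho> \<Longrightarrow> \<bar>c n x * z ^ n\<bar> \<le> M n"
    using geometric_on_majorant[OF assms(1) \<rho>(1,3)] by blast
  then have "summable M" "\<And>n. \<bar>c n x * z ^ n\<bar> \<le> M n" using assms(2) \<rho> by auto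
  then show ?thesis by - (rule summable_comparison_test'[of M 0], auto)
qed

lemma differentiable_family_diff_coeffs:
  "differentiable_family S R c c1 \<Longrightarrow> differentiable_family S R (diff_coeffs c) (diff_coeffs c1)"
  unfolding differentiable_family_def
  by (auto intro: geometric_on_diff_coeffs) (auto intro!: DERIV_cmult simp: diff_coeffs_def[abs_def])

lemma differentiable_family_diff_coeffs_iterate:
  "differentiable_family S R c c1 \<Longrightarrow> differentiable_family S R ((diff_coeffs ^^ m) c) ((diff_coeffs ^^ m) c1)"
  by (induction m) (auto intro: differentiable_family_diff_coeffs)

lemma param_series_shift_coeffs:
  assumes "geometric_on S R c" "x \<in> S" "\<bar>z\<bar> < R"
  shows "param_series (shift_coeffs c) x z = z * param_series c x z"
proof -
  have "summable (\<lambda>n. shift_coeffs c n x * z ^ n)"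
    by (rule summable_param_series[OF geometric_on_shift_coeffs[OF assms(1)] assms(2,3)])
  from suminf_split_head[OF this]
  have "param_series (shift_coeffs c) x z = (\<Sum>n. z * (c n x * z ^ n))"
    by (simp add: param_series_def shift_coeffs_def mult_ac)
  also have "\<dots> = z * param_series c x z"
    using summable_param_series[OF assms] by (simp add: param_series_def suminf_mult)
  finally show ?thesis .
qed

lemma param_series_linear:
  assumes "geometric_on S R c" "geometric_on S R d" "x \<in> S" "\<bar>z\<bar> < R"
  shows "param_series (\<lambda>n x. a x * c n x + b x * d n x) x z = a x * param_series c x z + b x * param_series d x z"
proof -
  have "(\<lambda>n. a x * (c n x * z ^ n) + b x * (d n x * z ^ n)) sums (a x * param_series c x z + b x * param_series d x z)"
    unfolding param_series_def using summable_param_series[OF assms(1,3,4)] summable_param_series[OF assms(2,3,4)]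
    by (intro sums_add sums_mult summable_sums)
  then show ?thesis unfolding param_series_def by (simp add: sums_iff algebra_simps)
qed

text \<open>Leibniz' rule for the \<open>m\<close>-th derivative of \<open>z\<close> times a series.\<close>

lemma diff_coeffs_iterate_shift_coeffs:
  "(diff_coeffs ^^ m) (shift_coeffs d) = (\<lambda>n x. shift_coeffs ((diff_coeffs ^^ m) d) n x + real m * (diff_coeffs ^^ (m - 1)) d n x)"
proof (induction m)
  case (Suc m)
  have "diff_coeffs (shift_coeffs e) n x = e n x + shift_coeffs (diff_coeffs e) n x" for e n x
    by (cases n) (auto simp: diff_coeffs_def shift_coeffs_def algebra_simps)
  moreover have "diff_coeffs (\<lambda>n x. a n x + real m * b n x) n x = diff_coeffs a n x + real m * diff_coeffs b n x"
    for a b :: "nat \<Rightarrow> real \<Rightarrow> real" and n x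
    by (simp add: diff_coeffs_def algebra_simps)
  ultimately have "(diff_coeffs ^^ Suc m) (shift_coeffs d) n x =
      (diff_coeffs ^^ m) d n x + shift_coeffs (diff_coeffs ((diff_coeffs ^^ m) d)) n x + real m * diff_coeffs ((diff_coeffs ^^ (m - 1)) d) n x" for n x
    by (simp add: Suc)
  then show ?case by (cases m) (auto simp: fun_eq_iff algebra_simps)
qed (auto simp: fun_eq_iff)

lemma param_series_diff_coeffs_iterate_shift_coeffs:
  assumes "geometric_on S R d" "x \<in> S" "\<bar>z\<bar> < R"
  shows "param_series ((diff_coeffs ^^ m) (shift_coeffs d)) x z =
    z * param_series ((diff_coeffs ^^ m) d) x z + real m * param_series ((diff_coeffs ^^ (m - 1)) d) x z"
proof -
  have geo: "geometric_on S R ((diff_coeffs ^^ k) d)" for k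
    by (induction k) (auto intro: assms geometric_on_diff_coeffs)
  show ?thesis
    using param_series_linear[OF geometric_on_shift_coeffs[OF geo] geo assms(2,3), of "\<lambda>_. 1" m "\<lambda>_. real m" "m - 1"]
      param_series_shift_coeffs[OF geo assms(2,3)]
    by (simp add: diff_coeffs_iterate_shift_coeffs)
qed

text \<open>Joint differentiability in \<open>(x, z)\<close>, by termwise differentiation. Total differentiability, and not just the
existence of partial derivatives, is needed to follow the series along a curve.\<close>

lemma param_series_has_derivative:
  assumes "convex S"
    and family: "differentiable_family S R c c1"
    and x: "x \<in> S" and z: "\<bar>z\<bar> < R"
  shows "((\<lambda>p. param_series c (fst p) (snd p)) has_derivative
          (\<lambda>h. param_series c1 x z * fst h + param_series (diff_coeffs c) x z * snd h)) (at (x, z) within S \<times> {-R<..<R})"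
proof -
  have c: "geometric_on S R c" and c1: "geometric_on S R c1"
    and der: "\<And>n x. x \<in> S \<Longrightarrow> (c n has_real_derivative c1 n x) (at x within S)"
    using family by (auto simp: differentiable_family_def)
  define \<rho> where "\<rho> = (\<bar>z\<bar> + R) / 2"
  have \<rho>: "0 < \<rho>" "\<bar>z\<bar> < \<rho>" "\<rho> < R" using z by (auto simp: \<rho>_def)
  \<comment> \<open>Convergence of the differentiated series is uniform only on smaller strips.\<close>
  define U where "U = S \<times> {-\<rho><..<\<rho>}"
  define f' where "f' n p h = (c1 n (fst p) * snd p ^ n) * fst h +
     (real n * c n (fst p) * snd p ^ (n - 1)) * snd h" for n and p h :: "real \<times> real"
  define g' where "g' p h = param_series c1 (fst p) (snd p) * fst h + param_series (diff_coeffs c) (fst p) (snd p) * snd h"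
    for p h :: "real \<times> real"
  have "\<exists>F. \<forall>p\<in>U. (\<lambda>n. c n (fst p) * snd p ^ n) sums F p \<and> (F has_derivative g' p) (at p within U)"
  proof (rule has_derivative_series)
    show "convex U" unfolding U_def using assms(1) by (intro convex_Times) auto
    show "(x, z) \<in> U" using x \<rho> by (auto simp: U_def)
    show "(\<lambda>n. c n (fst (x, z)) * snd (x, z) ^ n) sums param_series c x z"
      using summable_sums[OF summable_param_series[OF c x z]] by (simp add: param_series_def)
  next
    fix n p assume p: "p \<in> U"
    have "(c n has_derivative (\<lambda>h. c1 n (fst p) * h)) (at (fst p) within fst ` U)"
      using der[of "fst p" n] p unfolding U_def has_field_derivative_def
      by (auto intro: has_derivative_subset)
    from has_derivative_in_compose[OF has_derivative_fst[OF has_derivative_ident] this]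
    have "((\<lambda>p. c n (fst p)) has_derivative (\<lambda>h. c1 n (fst p) * fst h)) (at p within U)" .
    from has_derivative_mult[OF this has_derivative_power[OF has_derivative_snd[OF has_derivative_ident], of n]]
    show "((\<lambda>p. c n (fst p) * snd p ^ n) has_derivative f' n p) (at p within U)"
      by (rule has_derivative_eq_rhs) (auto simp: f'_def algebra_simps)
  next
    fix e :: real assume e: "0 < e"
    define A where "A n p = (\<Sum>i<n. c1 i (fst p) * snd p ^ i)" for n and p :: "real \<times> real"
    define B where "B n p = (\<Sum>i<n. real i * c i (fst p) * snd p ^ (i - 1))" for n and p :: "real \<times> real"
    obtain M where M: "summable M" "\<And>n x z. x \<in> S \<Longrightarrow> \<bar>z\<bar> \<le> \<rho> \<Longrightarrow> \<bar>c1 n x * z ^ n\<bar> \<le> M n"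
      using geometric_on_majorant[OF c1 \<rho>(1,3)] by blast
    have A: "uniform_limit U A (\<lambda>p. param_series c1 (fst p) (snd p)) sequentially"
      unfolding A_def param_series_def using M by (intro Weierstrass_m_test) (auto simp: U_def)
    obtain M' where M': "summable M'" "\<And>n x z. x \<in> S \<Longrightarrow> \<bar>z\<bar> \<le> \<rho> \<Longrightarrow> \<bar>diff_coeffs c n x * z ^ n\<bar> \<le> M' n"
      using geometric_on_majorant[OF geometric_on_diff_coeffs[OF c] \<rho>(1,3)] by blast
    have "uniform_limit U B (\<lambda>p. \<Sum>i. real i * c i (fst p) * snd p ^ (i - 1)) sequentially"
      unfolding B_def
    proof (rule Weierstrass_m_test)
      show "summable (\<lambda>n. case n of 0 \<Rightarrow> 0 | Suc m \<Rightarrow> M' m)"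
        using M'(1) by (subst summable_Suc_iff[symmetric]) simp
      fix n p assume "p \<in> U"
      then show "norm (real n * c n (fst p) * snd p ^ (n - 1)) \<le> (case n of 0 \<Rightarrow> 0 | Suc m \<Rightarrow> M' m)"
        using M'(2)[of "fst p" "snd p" "n - 1"] by (cases n) (auto simp: U_def diff_coeffs_def)
    qed
    moreover have "(\<Sum>i. real i * c i (fst p) * snd p ^ (i - 1)) = param_series (diff_coeffs c) (fst p) (snd p)"
      if "p \<in> U" for p
    proof -
      have "summable (\<lambda>n. diff_coeffs c n (fst p) * snd p ^ n)"
        using that \<rho> by (intro summable_param_series[OF geometric_on_diff_coeffs[OF c]]) (auto simp: U_def)
      then have "summable (\<lambda>n. real (Suc n) * c (Suc n) (fst p) * snd p ^ (Suc n - 1))"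
        by (simp add: diff_coeffs_def)
      then have "summable (\<lambda>i. real i * c i (fst p) * snd p ^ (i - 1))"
        by (subst summable_Suc_iff[symmetric])
      from suminf_split_head[OF this] show ?thesis
        by (simp add: param_series_def diff_coeffs_def)
    qed
    ultimately have B: "uniform_limit U B (\<lambda>p. param_series (diff_coeffs c) (fst p) (snd p)) sequentially"
      using uniform_limit_cong' by (smt (verit, best))
    have ev: "\<forall>\<^sub>F n in sequentially. \<forall>p\<in>U. dist (A n p) (param_series c1 (fst p) (snd p)) < e / 2 \<and>
                dist (B n p) (param_series (diff_coeffs c) (fst p) (snd p)) < e / 2"
      using eventually_conj[OF uniform_limitD[OF A, of "e/2"] uniform_limitD[OF B, of "e/2"]] e
      by (auto elim!: eventually_mono)
    show "\<forall>\<^sub>F n in sequentially. \<forall>p\<in>U. \<forall>h. norm ((\<Sum>i<n. f' i p h) - g' p h) \<le> e * norm h"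
      using ev
    proof (rule eventually_mono, intro ballI allI)
      fix n p and h :: "real \<times> real"
      assume *: "\<forall>p\<in>U. dist (A n p) (param_series c1 (fst p) (snd p)) < e / 2 \<and>
                dist (B n p) (param_series (diff_coeffs c) (fst p) (snd p)) < e / 2" and p: "p \<in> U"
      have "(\<Sum>i<n. f' i p h) - g' p h =
          (A n p - param_series c1 (fst p) (snd p)) * fst h + (B n p - param_series (diff_coeffs c) (fst p) (snd p)) * snd h"
        by (simp add: f'_def g'_def A_def B_def sum.distrib sum_distrib_left algebra_simps)
      also have "norm \<dots> \<le> e / 2 * norm (fst h) + e / 2 * norm (snd h)"
        using * p
        by (intro norm_triangle_le add_mono order.trans[OF norm_mult_ineq] mult_right_mono)
           (auto simp: dist_norm intro: less_imp_le)
      also have "\<dots> \<le> e / 2 * norm h + e / 2 * norm h"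
        using e norm_fst_le[of "fst h" "snd h"] norm_snd_le[of "snd h" "fst h"]
        by (intro add_mono mult_left_mono) auto
      finally show "norm ((\<Sum>i<n. f' i p h) - g' p h) \<le> e * norm h" by simp
    qed
  qed
  then obtain F where F: "\<And>p. p \<in> U \<Longrightarrow> (\<lambda>n. c n (fst p) * snd p ^ n) sums F p"
      "\<And>p. p \<in> U \<Longrightarrow> (F has_derivative g' p) (at p within U)" by blast
  have xz: "(x, z) \<in> U" using x \<rho> by (auto simp: U_def)
  have "((\<lambda>p. param_series c (fst p) (snd p)) has_derivative g' (x, z)) (at (x, z) within U)"
    by (rule has_derivative_transform_within[OF F(2)[OF xz] zero_less_one xz])
       (use F(1) in \<open>auto simp: param_series_def sums_iff\<close>)
  moreover have "at (x, z) within U = at (x, z) within S \<times> {-R<..<R}"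
    by (rule at_within_nhd[where S="UNIV \<times> {-\<rho><..<\<rho>}"]) (use \<rho> in \<open>auto simp: U_def open_Times\<close>)
  ultimately show ?thesis by (simp add: g'_def[abs_def])
qed

lemma param_series_continuous_on:
  assumes "convex S" "differentiable_family S R c c1"
  shows "continuous_on (S \<times> {-R<..<R}) (\<lambda>p. param_series c (fst p) (snd p))"
proof (rule has_derivative_continuous_on)
  fix p assume "p \<in> S \<times> {-R<..<R}"
  then have p: "fst p \<in> S" "\<bar>snd p\<bar> < R" by auto
  have "((\<lambda>p. param_series c (fst p) (snd p)) has_derivative
          (\<lambda>h. param_series c1 (fst p) (snd p) * fst h + param_series (diff_coeffs c) (fst p) (snd p) * snd h))
         (at (fst p, snd p) within S \<times> {-R<..<R})"
    by (rule param_series_has_derivative[OF assms p])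
  then show "((\<lambda>p. param_series c (fst p) (snd p)) has_derivative
          (\<lambda>h. param_series c1 (fst p) (snd p) * fst h + param_series (diff_coeffs c) (fst p) (snd p) * snd h))
         (at p within S \<times> {-R<..<R})" by simp
qed

lemma param_series_differentiable_along:
  assumes "convex S"
    and family: "differentiable_family S R c c1"
    and X: "(X has_real_derivative X') (at t within T)" and Z: "(Z has_real_derivative Z') (at t within T)"
    and img: "\<And>t. t \<in> T \<Longrightarrow> X t \<in> S \<and> \<bar>Z t\<bar> < R" and t: "t \<in> T"
  shows "((\<lambda>t. param_series c (X t) (Z t)) has_real_derivative
          param_series c1 (X t) (Z t) * X' + param_series (diff_coeffs c) (X t) (Z t) * Z') (at t within T)"
proof -
  have sub: "(X t, Z t) \<in> S \<times> {-R<..<R}" if "t \<in> T" for t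
    using img[OF that] by auto
  have "((\<lambda>t. (X t, Z t)) has_derivative (\<lambda>h. (X' * h, Z' * h))) (at t within T)"
    using X Z unfolding has_field_derivative_def by (rule has_derivative_Pair)
  moreover have "((\<lambda>p. param_series c (fst p) (snd p)) has_derivative
          (\<lambda>h. param_series c1 (X t) (Z t) * fst h + param_series (diff_coeffs c) (X t) (Z t) * snd h))
          (at (X t, Z t) within (\<lambda>t. (X t, Z t)) ` T)"
    by (rule has_derivative_subset[OF param_series_has_derivative[OF assms(1) family]])
       (use img[OF t] sub in auto)
  ultimately have "((\<lambda>t. param_series c (fst (X t, Z t)) (snd (X t, Z t))) has_derivative
      (\<lambda>h. param_series c1 (X t) (Z t) * fst (X' * h, Z' * h) + param_series (diff_coeffs c) (X t) (Z t) * snd (X' * h, Z' * h)))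
      (at t within T)"
    by (rule has_derivative_in_compose[where f="\<lambda>t. (X t, Z t)"])
  then have "((\<lambda>t. param_series c (X t) (Z t)) has_derivative
      (\<lambda>h. param_series c1 (X t) (Z t) * (X' * h) + param_series (diff_coeffs c) (X t) (Z t) * (Z' * h))) (at t within T)"
    by (simp only: fst_conv snd_conv)
  then show ?thesis
    unfolding has_field_derivative_def
    by (rule has_derivative_eq_rhs) (simp add: fun_eq_iff algebra_simps)
qed

section \<open>Implicit functions of one real variable\<close>

text \<open>The inverse function theorem is applied to \<open>(x, z) \<mapsto> (F (x, z), z)\<close>. The formula for the derivative then follows
by differentiating \<open>F (X z, z) = 0\<close>.\<close>

lemma implicit_function_real:
  fixes F Fx Fz :: "real \<times> real \<Rightarrow> real"
  assumes U: "open U" "(x0, 0) \<in> U"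
    and der: "\<And>p. p \<in> U \<Longrightarrow> (F has_derivative (\<lambda>h. Fx p * fst h + Fz p * snd h)) (at p)"
    and cont: "continuous_on U Fx" "continuous_on U Fz"
    and zero: "F (x0, 0) = 0" and nz: "Fx (x0, 0) \<noteq> 0"
  obtains r X where "0 < r" "X 0 = x0"
    "\<And>z. \<bar>z\<bar> < r \<Longrightarrow> (X z, z) \<in> U \<and> F (X z, z) = 0 \<and> Fx (X z, z) \<noteq> 0 \<and>
        (X has_real_derivative - Fz (X z, z) / Fx (X z, z)) (at z)"
proof -
  define a1 where "a1 = Blinfun (\<lambda>h::real\<times>real. (fst h, 0::real))"
  define a2 where "a2 = Blinfun (\<lambda>h::real\<times>real. (snd h, 0::real))"
  define a3 where "a3 = Blinfun (\<lambda>h::real\<times>real. (0::real, snd h))"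
  have app [simp]: "blinfun_apply a1 h = (fst h, 0)" "blinfun_apply a2 h = (snd h, 0)"
      "blinfun_apply a3 h = (0, snd h)" for h
    unfolding a1_def a2_def a3_def
    by (subst bounded_linear_Blinfun_apply; auto intro!: bounded_linear_Pair bounded_linear_fst bounded_linear_snd)+
  define f where "f p = (F p, snd p)" for p
  define f' where "f' p = Fx p *\<^sub>R a1 + Fz p *\<^sub>R a2 + a3" for p
  have f'_apply: "blinfun_apply (f' p) h = (Fx p * fst h + Fz p * snd h, snd h)" for p h
    by (simp add: f'_def blinfun.add_left blinfun.scaleR_left)
  define k where "k = Fx (x0, 0)"
  \<comment> \<open>The inverse of the matrix with rows \<open>(Fx, Fz)\<close> and \<open>(0, 1)\<close> at the base point.\<close>
  define invf where "invf = inverse k *\<^sub>R a1 - (Fz (x0, 0) / k) *\<^sub>R a2 + a3"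
  have invf: "invf o\<^sub>L f' (x0, 0) = id_blinfun"
    using nz by (intro blinfun_eqI)
      (auto simp: f'_apply invf_def blinfun.add_left blinfun.diff_left blinfun.scaleR_left k_def prod_eq_iff field_simps)
  have derf: "(f has_derivative blinfun_apply (f' p)) (at p)" if "p \<in> U" for p
  proof -
    have "(f has_derivative (\<lambda>h. (Fx p * fst h + Fz p * snd h, snd h))) (at p)"
      unfolding f_def by (intro has_derivative_Pair der that has_derivative_snd has_derivative_ident)
    moreover have "blinfun_apply (f' p) = (\<lambda>h. (Fx p * fst h + Fz p * snd h, snd h))"
      using f'_apply by blast
    ultimately show ?thesis by simp
  qed
  have contf: "continuous_on U f'" unfolding f'_def by (intro continuous_intros cont)
  obtain U' V G G' where "open U'" and U': "U' \<subseteq> U" "(x0, 0) \<in> U'"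
    and V: "open V" "f (x0, 0) \<in> V" and hom: "homeomorphism U' V f G"
    and derG: "\<And>y. y \<in> V \<Longrightarrow> (G has_derivative G' y) (at y)"
    and "\<And>y. y \<in> V \<Longrightarrow> G' y = inv (blinfun_apply (f' (G y)))"
    and bij: "\<And>y. y \<in> V \<Longrightarrow> bij (blinfun_apply (f' (G y)))"
    by (rule inverse_function_theorem[OF U(1) derf contf U(2) invf], assumption, rule that)
  have "(0, 0) \<in> V" using V(2) by (simp add: f_def zero)
  then obtain e where e: "0 < e" "ball (0, 0) e \<subseteq> V" using V(1) by (meson openE)
  have inV: "(0, z) \<in> V" if "\<bar>z\<bar> < e" for z
    using e(2) that by (force simp: dist_Pair_Pair dist_real_def)
  define X where "X z = fst (G (0, z))" for z
  have main: "(X z, z) \<in> U \<and> F (X z, z) = 0 \<and> Fx (X z, z) \<noteq> 0" and Gz: "G (0, z) = (X z, z)" if "\<bar>z\<bar> < e" for z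
  proof -
    have "f (G (0, z)) = (0, z)" using homeomorphism_apply2[OF hom inV[OF that]] .
    then have "snd (G (0, z)) = z" by (simp add: f_def)
    then show Gz: "G (0, z) = (X z, z)" unfolding X_def by (metis prod.collapse)
    have "G (0, z) \<in> U'" using homeomorphism_image2[OF hom] inV[OF that] by blast
    then have "(X z, z) \<in> U" unfolding Gz using U'(1) by blast
    moreover have "F (X z, z) = 0" using \<open>f (G (0, z)) = (0, z)\<close> unfolding Gz by (simp add: f_def)
    moreover have "Fx (X z, z) \<noteq> 0"
    proof
      assume "Fx (X z, z) = 0"
      then have "blinfun_apply (f' (G (0, z))) (1, 0) = blinfun_apply (f' (G (0, z))) (0, 0)"
        unfolding f'_apply Gz by simp
      then show False using bij_is_inj[OF bij[OF inV[OF that]]] by (metis injD prod.inject zero_neq_one)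
    qed
    ultimately show "(X z, z) \<in> U \<and> F (X z, z) = 0 \<and> Fx (X z, z) \<noteq> 0" by blast
  qed
  have "G (0, 0) = (x0, 0)"
    using homeomorphism_apply1[OF hom U'(2)] by (simp add: f_def zero)
  then have X0: "X 0 = x0" by (simp add: X_def)
  have "(X has_real_derivative - Fz (X z, z) / Fx (X z, z)) (at z)" if z: "\<bar>z\<bar> < e" for z
  proof -
    have "((\<lambda>z. (0::real, z)) has_derivative (\<lambda>h. (0, h))) (at z)"
      by (intro has_derivative_Pair has_derivative_const has_derivative_ident)
    from has_derivative_compose[OF this derG[OF inV[OF z]]]
    have "((\<lambda>z. G (0, z)) has_derivative (\<lambda>h. G' (0, z) (0, h))) (at z)" .
    from has_derivative_fst[OF this]
    have "X differentiable (at z)" unfolding X_def[abs_def] differentiable_def by blast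
    then obtain D where D: "(X has_real_derivative D) (at z)"
      using real_differentiable_def by blast
    have "((\<lambda>z. (X z, z)) has_derivative (\<lambda>h. (D * h, h))) (at z)"
      using D unfolding has_field_derivative_def by (intro has_derivative_Pair has_derivative_ident)
    moreover have "(F has_derivative (\<lambda>h. Fx (X z, z) * fst h + Fz (X z, z) * snd h)) (at (X z, z))"
      using der main[OF z] by blast
    ultimately have "((\<lambda>z. F (X z, z)) has_derivative
        (\<lambda>h. Fx (X z, z) * fst (D * h, h) + Fz (X z, z) * snd (D * h, h))) (at z)"
      by (rule has_derivative_compose)
    then have "((\<lambda>z. F (X z, z)) has_real_derivative Fx (X z, z) * D + Fz (X z, z)) (at z)"
      unfolding has_field_derivative_def
      by (rule has_derivative_eq_rhs) (simp add: fun_eq_iff algebra_simps)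
    moreover have "((\<lambda>z. F (X z, z)) has_real_derivative 0) (at z)"
    proof (rule has_field_derivative_transform_within[where f="\<lambda>_. 0"])
      show "0 < e - \<bar>z\<bar>" using z by simp
      show "0 = F (X w, w)" if "dist w z < e - \<bar>z\<bar>" for w
        using main[of w] that by (auto simp: dist_real_def)
    qed auto
    ultimately have "Fx (X z, z) * D + Fz (X z, z) = 0" by (rule DERIV_unique)
    then have "D = - Fz (X z, z) / Fx (X z, z)" using main[OF z] by (simp add: field_simps)
    then show ?thesis using D by simp
  qed
  then show thesis using that[of e X, OF e(1) X0] main by blast
qed

section \<open>Solutions of the coupled system as power series in \<open>z\<close>\<close>

text \<open>The coefficient form of \<open>u'' + q u = e z v\<close>, where \<open>c\<close>, \<open>c1\<close>, \<open>d\<close> are the coefficients of \<open>u\<close>, \<open>u'\<close>, \<open>v\<close>. The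
coupled system consists of two such families, with the signs \<open>e = - 1\<close> and \<open>e = 1\<close>.\<close>

definition forced_family ::
    "real \<Rightarrow> (real \<Rightarrow> real) \<Rightarrow> real \<Rightarrow> real \<Rightarrow> (nat \<Rightarrow> real \<Rightarrow> real) \<Rightarrow> (nat \<Rightarrow> real \<Rightarrow> real) \<Rightarrow>
      (nat \<Rightarrow> real \<Rightarrow> real) \<Rightarrow> bool" where
  "forced_family L q e R c c1 d \<longleftrightarrow>
     differentiable_family {0..L} R c c1 \<and> geometric_on {0..L} R d \<and>
     (\<forall>n. ode_solution L q (\<lambda>x. e * shift_coeffs d n x) (c n) (c1 n))"

lemma forced_family_mono:
  "forced_family L q e R c c1 d \<Longrightarrow> R' \<le> R \<Longrightarrow> forced_family L q e R' c c1 d"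
  unfolding forced_family_def differentiable_family_def geometric_on_def by fastforce

lemma forced_family_second_derivative:
  assumes q: "continuous_on {0..L} q" and F: "forced_family L q e R c c1 d"
  shows "differentiable_family {0..L} R c1 (\<lambda>n x. e * shift_coeffs d n x - q x * c n x)"
proof -
  obtain Q where "\<forall>x\<in>{0..L}. \<bar>q x\<bar> \<le> Q"
    using continuous_on_Icc_bounded[OF q] by blast
  then have Q: "\<bar>- q x\<bar> \<le> Q" if "x \<in> {0..L}" for x using that by simp
  have d: "geometric_on {0..L} R (\<lambda>n x. e * shift_coeffs d n x)"
    using F by (intro geometric_on_mult[where K="\<bar>e\<bar>"] geometric_on_shift_coeffs) (auto simp: forced_family_def)
  have c: "geometric_on {0..L} R (\<lambda>n x. - q x * c n x)"
    using F by (intro geometric_on_mult[OF _ Q]) (auto simp: forced_family_def differentiable_family_def)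
  have "geometric_on {0..L} R (\<lambda>n x. e * shift_coeffs d n x - q x * c n x)"
    using geometric_on_add[OF d c] by simp
  then show ?thesis
    using F unfolding forced_family_def differentiable_family_def ode_solution_def by auto
qed

lemma param_series_second_derivative:
  assumes F: "forced_family L q e R c c1 d" and x: "x \<in> {0..L}" and z: "\<bar>z\<bar> < R"
  shows "param_series ((diff_coeffs ^^ m) (\<lambda>n x. e * shift_coeffs d n x - q x * c n x)) x z =
    e * (z * param_series ((diff_coeffs ^^ m) d) x z + real m * param_series ((diff_coeffs ^^ (m - 1)) d) x z)
      - q x * param_series ((diff_coeffs ^^ m) c) x z"
proof -
  have *: "(diff_coeffs ^^ m) (\<lambda>n x. e * shift_coeffs d n x - q x * c n x) =
      (\<lambda>n x. e * (diff_coeffs ^^ m) (shift_coeffs d) n x + (- q x) * (diff_coeffs ^^ m) c n x)"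
  proof (induction m)
    case (Suc m)
    have "diff_coeffs (\<lambda>n x. e * a n x + - q x * b n x) = (\<lambda>n x. e * diff_coeffs a n x + - q x * diff_coeffs b n x)"
      for a b by (simp add: fun_eq_iff diff_coeffs_def algebra_simps)
    then show ?case by (simp add: Suc)
  qed simp
  have geo: "geometric_on {0..L} R ((diff_coeffs ^^ m) (shift_coeffs d))" "geometric_on {0..L} R ((diff_coeffs ^^ m) c)"
    using F by (induction m) (auto simp: forced_family_def differentiable_family_def
        intro: geometric_on_diff_coeffs geometric_on_shift_coeffs)
  have d: "geometric_on {0..L} R d" using F by (simp add: forced_family_def)
  show ?thesis
    unfolding * param_series_linear[OF geo x z] param_series_diff_coeffs_iterate_shift_coeffs[OF d x z] by simp
qed

lemma param_series_in_x:
  assumes F: "forced_family L q e R c c1 d" and q: "continuous_on {0..L} q"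
    and x: "x \<in> {0..L}" and z: "\<bar>z\<bar> < R"
  shows "((\<lambda>x. param_series c x z) has_real_derivative param_series c1 x z) (at x within {0..L})"
    and "((\<lambda>x. param_series c1 x z) has_real_derivative e * (z * param_series d x z) - q x * param_series c x z) (at x within {0..L})"
proof -
  have *: "((\<lambda>x. param_series f x z) has_real_derivative param_series f1 x z) (at x within {0..L})"
    if "differentiable_family {0..L} R f f1" for f f1
    using param_series_differentiable_along[OF _ that DERIV_ident DERIV_const[of z] _ x] z by simp
  show "((\<lambda>x. param_series c x z) has_real_derivative param_series c1 x z) (at x within {0..L})"
    using F by (intro *) (simp add: forced_family_def)
  show "((\<lambda>x. param_series c1 x z) has_real_derivative e * (z * param_series d x z) - q x * param_series c x z) (at x within {0..L})"
    using *[OF forced_family_second_derivative[OF q F]] param_series_second_derivative[OF F x z, of 0] by simp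
qed

text \<open>The coefficient of \<open>z\<^sup>n\<^sup>+\<^sup>1\<close> in one component solves an equation whose right-hand side is the coefficient of \<open>z\<^sup>n\<close>
in the other one. The coefficients of order \<open>0\<close> carry the initial slopes.\<close>

lemma coupled_families_exist:
  assumes g: "continuous_on {0..L} g" and h: "continuous_on {0..L} h" and L: "0 \<le> L"
  obtains R c c1 d d1 where "0 < R" "forced_family L g (-1) R c c1 d" "forced_family L h 1 R d d1 c"
    "\<And>n. c n 0 = 0" "\<And>n. d n 0 = 0"
    "\<And>n. c1 n 0 = (if n = 0 then \<alpha> else 0)" "\<And>n. d1 n 0 = (if n = 0 then \<beta> else 0)"
proof -
  obtain G where G: "\<And>f. continuous_on {0..L} f \<Longrightarrow>
    (\<exists>y y1. ode_solution L g f y y1 \<and> y 0 = 0 \<and> y1 0 = 0 \<and>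
       (\<forall>B. (\<forall>x\<in>{0..L}. \<bar>f x\<bar> \<le> B) \<longrightarrow>
            (\<forall>x\<in>{0..L}. \<bar>y x\<bar> \<le> G * B \<and> \<bar>y1 x\<bar> \<le> G * B)))"
    using ode_solution_exists_bounded[OF g L] by blast
  obtain H where H: "\<And>f. continuous_on {0..L} f \<Longrightarrow>
    (\<exists>y y1. ode_solution L h f y y1 \<and> y 0 = 0 \<and> y1 0 = 0 \<and>
       (\<forall>B. (\<forall>x\<in>{0..L}. \<bar>f x\<bar> \<le> B) \<longrightarrow>
            (\<forall>x\<in>{0..L}. \<bar>y x\<bar> \<le> H * B \<and> \<bar>y1 x\<bar> \<le> H * B)))"
    using ode_solution_exists_bounded[OF h L] by blast
  \<comment> \<open>Each step of the recursion enlarges the sup norms at most by \<open>K\<close>, so the radius \<open>1 / K\<close> will do.\<close>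
  define K where "K = 1 + \<bar>G\<bar> + \<bar>H\<bar>"
  have K: "0 < K" "G \<le> K" "H \<le> K" by (auto simp: K_def)
  obtain a a1 where a: "ode_solution L g (\<lambda>_. 0) a a1" "a 0 = 0" "a1 0 = \<alpha>"
    by (rule ode_solution_exists[OF g L continuous_on_const])
  obtain b b1 where b: "ode_solution L h (\<lambda>_. 0) b b1" "b 0 = 0" "b1 0 = \<beta>"
    by (rule ode_solution_exists[OF h L continuous_on_const])
  note bounded = continuous_on_Icc_bounded[OF ode_solution_continuous(1)]
    continuous_on_Icc_bounded[OF ode_solution_continuous(2)]
  from bounded[OF a(1)] bounded[OF b(1)] obtain B1 B2 B3 B4 where B14:
    "\<forall>x\<in>{0..L}. \<bar>a x\<bar> \<le> B1" "\<forall>x\<in>{0..L}. \<bar>a1 x\<bar> \<le> B2"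
    "\<forall>x\<in>{0..L}. \<bar>b x\<bar> \<le> B3" "\<forall>x\<in>{0..L}. \<bar>b1 x\<bar> \<le> B4"
    by blast
  define B where "B = \<bar>B1\<bar> + \<bar>B2\<bar> + \<bar>B3\<bar> + \<bar>B4\<bar>"
  have B: "0 \<le> B" "\<forall>x\<in>{0..L}. \<bar>a x\<bar> \<le> B \<and> \<bar>a1 x\<bar> \<le> B \<and> \<bar>b x\<bar> \<le> B \<and> \<bar>b1 x\<bar> \<le> B"
    using B14 unfolding B_def by fastforce+
  define bd where "bd n f \<longleftrightarrow> (\<forall>x\<in>{0..L}. \<bar>f x\<bar> \<le> B * K ^ n)" for n :: nat and f :: "real \<Rightarrow> real"
  \<comment> \<open>The coefficients are picked by dependent choice, so the bound has to be carried along in the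
  invariant.\<close>
  define P where "P n = (\<lambda>(c, c1, d, d1). continuous_on {0..L} c \<and> continuous_on {0..L} d \<and>
      bd n c \<and> bd n c1 \<and> bd n d \<and> bd n d1 \<and> c 0 = 0 \<and> d 0 = 0 \<and>
      c1 0 = (if n = 0 then \<alpha> else 0) \<and> d1 0 = (if n = 0 then \<beta> else 0) \<and>
      (n = 0 \<longrightarrow> ode_solution L g (\<lambda>_. 0) c c1 \<and> ode_solution L h (\<lambda>_. 0) d d1))" for n :: nat
  define Q where "Q = (\<lambda>(n::nat) (c, c1 :: real \<Rightarrow> real, d, d1 :: real \<Rightarrow> real) (c', c1', d', d1').
      ode_solution L g (\<lambda>x. - d x) c' c1' \<and> ode_solution L h c d' d1')"
  have "\<exists>t. \<forall>n. P n (t n) \<and> Q n (t n) (t (Suc n))"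
  proof (rule dependent_nat_choice)
    show "\<exists>t. P 0 t"
      using a b B(2) ode_solution_continuous[OF a(1)] ode_solution_continuous[OF b(1)]
      by (intro exI[of _ "(a, a1, b, b1)"]) (auto simp: P_def bd_def)
  next
    fix t n assume t: "P n t"
    obtain c c1 d d1 where t_eq: "t = (c, c1, d, d1)" by (cases t)
    have cont: "continuous_on {0..L} c" "continuous_on {0..L} d" and bds: "bd n c" "bd n d"
      using t by (auto simp: P_def t_eq)
    have step: "M * (B * K ^ n) \<le> B * K ^ Suc n" if "M \<le> K" for M
      using mult_right_mono[OF that, of "B * K ^ n"] B(1) K by (simp add: mult_ac)
    obtain u u1 where u: "ode_solution L g (\<lambda>x. - d x) u u1" "u 0 = 0" "u1 0 = 0"
      "\<And>B. (\<forall>x\<in>{0..L}. \<bar>- d x\<bar> \<le> B) \<Longrightarrow> (\<forall>x\<in>{0..L}. \<bar>u x\<bar> \<le> G * B \<and> \<bar>u1 x\<bar> \<le> G * B)"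
      using G[of "\<lambda>x. - d x"] cont continuous_on_minus by blast
    obtain v v1 where v: "ode_solution L h c v v1" "v 0 = 0" "v1 0 = 0"
      "\<And>B. (\<forall>x\<in>{0..L}. \<bar>c x\<bar> \<le> B) \<Longrightarrow> (\<forall>x\<in>{0..L}. \<bar>v x\<bar> \<le> H * B \<and> \<bar>v1 x\<bar> \<le> H * B)"
      using H[of c] cont by blast
    have "bd (Suc n) u" "bd (Suc n) u1"
      using u(4)[of "B * K ^ n"] bds(2) step[OF K(2)] unfolding bd_def by force+
    moreover have "bd (Suc n) v" "bd (Suc n) v1"
      using v(4)[of "B * K ^ n"] bds(1) step[OF K(3)] unfolding bd_def by force+
    ultimately show "\<exists>t'. P (Suc n) t' \<and> Q n t t'"
      using u v ode_solution_continuous[OF u(1)] ode_solution_continuous[OF v(1)]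
      by (intro exI[of _ "(u, u1, v, v1)"]) (auto simp: P_def Q_def t_eq)
  qed
  then obtain t where t: "\<And>n. P n (t n)" "\<And>n. Q n (t n) (t (Suc n))" by blast
  define c where "c n = fst (t n)" for n
  define c1 where "c1 n = fst (snd (t n))" for n
  define d where "d n = fst (snd (snd (t n)))" for n
  define d1 where "d1 n = snd (snd (snd (t n)))" for n
  have tn: "t n = (c n, c1 n, d n, d1 n)" for n by (simp add: c_def c1_def d_def d1_def)
  note P = t(1)[unfolded tn P_def prod.case] and Q = t(2)[unfolded tn Q_def prod.case]
  have geo: "geometric_on {0..L} (1 / K) f" if "\<And>n. bd n (f n)" for f
    unfolding geometric_on_def
  proof (intro allI impI exI[of _ B] ballI)
    fix \<rho> n x assume \<rho>: "0 < \<rho> \<and> \<rho> < 1 / K" and x: "x \<in> {0..L}"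
    have "\<bar>f n x\<bar> * \<rho> ^ n \<le> B * K ^ n * \<rho> ^ n"
      using that[of n] x \<rho> unfolding bd_def by (intro mult_right_mono) auto
    also have "\<dots> = B * (K * \<rho>) ^ n" by (simp add: power_mult_distrib)
    also have "\<dots> \<le> B * 1"
      using \<rho> K B by (intro mult_left_mono power_le_one) (auto simp: field_simps)
    finally show "\<bar>f n x\<bar> * \<rho> ^ n \<le> B" by simp
  qed
  have geos: "geometric_on {0..L} (1 / K) c" "geometric_on {0..L} (1 / K) c1"
    "geometric_on {0..L} (1 / K) d" "geometric_on {0..L} (1 / K) d1"
    using P by (auto intro!: geo)
  have ode: "ode_solution L g (\<lambda>x. - 1 * shift_coeffs d n x) (c n) (c1 n)"
      "ode_solution L h (\<lambda>x. 1 * shift_coeffs c n x) (d n) (d1 n)" for n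
    using P[of 0] Q[of "n - 1"] by (cases n; simp add: shift_coeffs_def)+
  show thesis
  proof (rule that)
    show "0 < 1 / K" using K by simp
    show "forced_family L g (-1) (1 / K) c c1 d" "forced_family L h 1 (1 / K) d d1 c"
      unfolding forced_family_def differentiable_family_def
      using geos ode by (auto simp: ode_solution_def)
  qed (use P in auto)
qed

text \<open>One step of the bootstrapping. By the chain rule, the derivative of \<open>z \<mapsto> \<partial>\<^sub>z\<^sup>m u (X z, z)\<close> involves \<open>X'\<close>, the
next \<open>z\<close>-derivative, and \<open>\<partial>\<^sub>z\<^sup>m u'\<close>; for \<open>u'\<close> in place of \<open>u\<close>, the equation expresses \<open>u''\<close> by \<open>u\<close>, \<open>v\<close> and the
potential. So the system closes, provided that it is considered for all \<open>m\<close> at once.\<close>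

lemma forced_family_Ck_along:
  assumes q: "continuous_on {0..L} q" and F: "forced_family L q e R c c1 d"
    and X: "\<And>z. z \<in> {-r<..<r} \<Longrightarrow> X z \<in> {0..L}" "r \<le> R"
    and XC: "Ck_on (Suc j) {-r<..<r} X" and qC: "Ck_on j {0..L} q"
    and IH: "\<And>m. Ck_on j {-r<..<r} (\<lambda>z. param_series ((diff_coeffs ^^ m) c) (X z) z)"
      "\<And>m. Ck_on j {-r<..<r} (\<lambda>z. param_series ((diff_coeffs ^^ m) c1) (X z) z)"
      "\<And>m. Ck_on j {-r<..<r} (\<lambda>z. param_series ((diff_coeffs ^^ m) d) (X z) z)"
  shows "Ck_on (Suc j) {-r<..<r} (\<lambda>z. param_series ((diff_coeffs ^^ m) c) (X z) z)"
    and "Ck_on (Suc j) {-r<..<r} (\<lambda>z. param_series ((diff_coeffs ^^ m) c1) (X z) z)"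
proof -
  let ?T = "{-r<..<r}"
  obtain X' where X': "\<And>z. z \<in> ?T \<Longrightarrow> (X has_real_derivative X' z) (at z within ?T)" "Ck_on j ?T X'"
    using XC unfolding Ck_on.simps by blast
  have img: "X z \<in> {0..L} \<and> \<bar>z\<bar> < R" if "z \<in> ?T" for z
    using X that by auto
  have along: "((\<lambda>z. param_series ((diff_coeffs ^^ m) a) (X z) z) has_real_derivative
      param_series ((diff_coeffs ^^ m) a1) (X z) z * X' z + param_series ((diff_coeffs ^^ Suc m) a) (X z) z * 1) (at z within ?T)"
    if "differentiable_family {0..L} R a a1" "z \<in> ?T" for a a1 z
    using param_series_differentiable_along[OF _ differentiable_family_diff_coeffs_iterate[OF that(1)] X'(1)[OF that(2)]
        DERIV_ident img that(2)] by simp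
  have Ck: "Ck_on (Suc j) ?T (\<lambda>z. param_series ((diff_coeffs ^^ m) a) (X z) z)"
    if "differentiable_family {0..L} R a a1"
      and "Ck_on j ?T (\<lambda>z. param_series ((diff_coeffs ^^ m) a1) (X z) z)"
      and "Ck_on j ?T (\<lambda>z. param_series ((diff_coeffs ^^ Suc m) a) (X z) z)" for a a1
    by (rule Ck_on_SucI[OF along[OF that(1)]])
       (auto intro!: Ck_on_add Ck_on_mult[OF that(2) X'(2)] that(3) simp del: funpow.simps)
  show "Ck_on (Suc j) ?T (\<lambda>z. param_series ((diff_coeffs ^^ m) c) (X z) z)"
    using F by (intro Ck[OF _ IH(2) IH(1)]) (simp add: forced_family_def)
  have "Ck_on j ?T (\<lambda>z. q (X z))"
    using X by (intro Ck_on_compose[OF qC Ck_on_SucD[OF XC]]) auto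
  then have "Ck_on j ?T (\<lambda>z. e * (z * param_series ((diff_coeffs ^^ m) d) (X z) z + real m * param_series ((diff_coeffs ^^ (m - 1)) d) (X z) z)
      - q (X z) * param_series ((diff_coeffs ^^ m) c) (X z) z)"
    by (intro Ck_on_diff Ck_on_mult[OF Ck_on_const] Ck_on_add Ck_on_mult[OF Ck_on_id] IH)
       (rule Ck_on_mult[OF _ IH(1)])
  then have "Ck_on j ?T (\<lambda>z. param_series ((diff_coeffs ^^ m) (\<lambda>n x. e * shift_coeffs d n x - q x * c n x)) (X z) z)"
    by (rule Ck_on_cong) (use img in \<open>simp add: param_series_second_derivative[OF F]\<close>)
  then show "Ck_on (Suc j) ?T (\<lambda>z. param_series ((diff_coeffs ^^ m) c1) (X z) z)"
    by (rule Ck[OF forced_family_second_derivative[OF q F] _ IH(2)])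
qed

lemma coupled_families_Ck_along:
  assumes g: "continuous_on {0..L} g" and h: "continuous_on {0..L} h"
    and F: "forced_family L g e R c c1 d" "forced_family L h e' R d d1 c"
    and X: "\<And>z. z \<in> {-r<..<r} \<Longrightarrow> X z \<in> {0..L}" "r \<le> R"
    and "Ck_on j {-r<..<r} X"
    and "\<And>i. Suc i \<le> j \<Longrightarrow> Ck_on i {0..L} g \<and> Ck_on i {0..L} h"
  shows "Ck_on j {-r<..<r} (\<lambda>z. param_series ((diff_coeffs ^^ m) c) (X z) z) \<and>
         Ck_on j {-r<..<r} (\<lambda>z. param_series ((diff_coeffs ^^ m) c1) (X z) z) \<and>
         Ck_on j {-r<..<r} (\<lambda>z. param_series ((diff_coeffs ^^ m) d) (X z) z) \<and>
         Ck_on j {-r<..<r} (\<lambda>z. param_series ((diff_coeffs ^^ m) d1) (X z) z)"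
  using assms(7,8)
proof (induction j arbitrary: m)
  case 0
  have cont: "continuous_on {-r<..<r} (\<lambda>z. param_series ((diff_coeffs ^^ m) a) (X z) z)"
    if "differentiable_family {0..L} R a a1" for a a1
  proof -
    have "continuous_on {-r<..<r} (\<lambda>z. (X z, z))"
      using 0 by (auto intro!: continuous_intros)
    moreover have "(\<lambda>z. (X z, z)) ` {-r<..<r} \<subseteq> {0..L} \<times> {-R<..<R}"
      using X by fastforce
    ultimately have "continuous_on {-r<..<r}
        (\<lambda>z. param_series ((diff_coeffs ^^ m) a) (fst (X z, z)) (snd (X z, z)))"
      by (rule continuous_on_compose2[OF
            param_series_continuous_on[OF convex_real_interval(5) differentiable_family_diff_coeffs_iterate[OF that]]])
    then show ?thesis by simp
  qed
  show ?case
    using F cont cont[OF forced_family_second_derivative[OF g F(1)]]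
      cont[OF forced_family_second_derivative[OF h F(2)]]
    by (auto simp: forced_family_def)
next
  case (Suc j)
  have IH: "Ck_on j {-r<..<r} (\<lambda>z. param_series ((diff_coeffs ^^ m) c) (X z) z)"
      "Ck_on j {-r<..<r} (\<lambda>z. param_series ((diff_coeffs ^^ m) c1) (X z) z)"
      "Ck_on j {-r<..<r} (\<lambda>z. param_series ((diff_coeffs ^^ m) d) (X z) z)"
      "Ck_on j {-r<..<r} (\<lambda>z. param_series ((diff_coeffs ^^ m) d1) (X z) z)" for m
    using Suc.IH[OF Ck_on_SucD[OF Suc.prems(1)], of m] Suc.prems(2) by auto
  have gh: "Ck_on j {0..L} g" "Ck_on j {0..L} h" using Suc.prems(2)[of j] by auto
  show ?case
    using forced_family_Ck_along[OF g F(1) X Suc.prems(1) gh(1) IH(1,2,3), of m]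
      forced_family_Ck_along[OF h F(2) X Suc.prems(1) gh(2) IH(3,4,1), of m]
    by blast
qed

section \<open>The curve of eigenvalues\<close>

lemma singular_2x2:
  fixes p q r s :: real
  assumes "p * s - q * r = 0"
  obtains \<alpha> \<beta> where "\<alpha> \<noteq> 0 \<or> \<beta> \<noteq> 0" "\<alpha> * p + \<beta> * q = 0" "\<alpha> * r + \<beta> * s = 0"
proof (cases "p = 0 \<and> q = 0")
  case True
  then show thesis
    using that[of s "- r"] that[of 1 0] by (cases "r = 0 \<and> s = 0") (auto simp: mult.commute)
next
  case False
  then show thesis using that[of q "- p"] assms by (auto simp: algebra_simps)
qed

text \<open>A null vector of the singular matrix combines the two fundamental solutions into one that vanishes at \<open>X\<close>. It
is not identically zero, as the null vector consists of its slopes at \<open>0\<close>.\<close>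

lemma dirichlet_eigenvalue_if_singular:
  assumes g: "continuous_on {0..L} g" and h: "continuous_on {0..L} h"
    and F: "forced_family L g (-1) R c c1 d" "forced_family L h 1 R d d1 c"
    and F': "forced_family L g (-1) R c' c1' d'" "forced_family L h 1 R d' d1' c'"
    and zero: "\<And>n. c n 0 = 0 \<and> d n 0 = 0 \<and> c' n 0 = 0 \<and> d' n 0 = 0"
    and init: "\<And>n. c1 n 0 = (if n = 0 then 1 else 0) \<and> d1 n 0 = 0"
      "\<And>n. c1' n 0 = 0 \<and> d1' n 0 = (if n = 0 then 1 else 0)"
    and X: "0 < X" "X \<le> L" and z: "\<bar>z\<bar> < R"
    and sing: "param_series c X z * param_series d' X z - param_series c' X z * param_series d X z = 0"
  shows "dirichlet_eigenvalue g h X z"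
proof -
  obtain \<alpha> \<beta> where nz: "\<alpha> \<noteq> 0 \<or> \<beta> \<noteq> 0"
    and uX: "\<alpha> * param_series c X z + \<beta> * param_series c' X z = 0" and vX: "\<alpha> * param_series d X z + \<beta> * param_series d' X z = 0"
    using singular_2x2[OF sing] by blast
  define U where "U f f' x = \<alpha> * param_series f x z + \<beta> * param_series f' x z" for f f' :: "nat \<Rightarrow> real \<Rightarrow> real" and x
  have p0: "param_series f 0 z = f 0 0" if "\<And>n. n \<noteq> 0 \<Longrightarrow> f n 0 = 0" for f :: "nat \<Rightarrow> real \<Rightarrow> real"
  proof -
    have "param_series f 0 z = (\<Sum>n\<in>{0}. f n 0 * z ^ n)"
      unfolding param_series_def by (rule suminf_finite) (use that in auto)
    then show ?thesis by simp
  qed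
  have der: "(U c c' has_real_derivative U c1 c1' x) (at x within {0..X})"
    "(U c1 c1' has_real_derivative - (z * U d d' x) - g x * U c c' x) (at x within {0..X})"
    "(U d d' has_real_derivative U d1 d1' x) (at x within {0..X})"
    "(U d1 d1' has_real_derivative z * U c c' x - h x * U d d' x) (at x within {0..X})"
    if "x \<in> {0..X}" for x
  proof -
    have x: "x \<in> {0..L}" using that X by auto
    have sub: "(f has_real_derivative D) (at x within {0..L}) \<Longrightarrow> (f has_real_derivative D) (at x within {0..X})"
      for f D by (rule has_field_derivative_subset) (use X in auto)
    note D = param_series_in_x[OF F(1) g x z] param_series_in_x[OF F(2) h x z] param_series_in_x[OF F'(1) g x z] param_series_in_x[OF F'(2) h x z]
    show "(U c c' has_real_derivative U c1 c1' x) (at x within {0..X})"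
      unfolding U_def[abs_def] by (rule sub) (rule derivative_eq_intros D refl | simp)+
    show "(U c1 c1' has_real_derivative - (z * U d d' x) - g x * U c c' x) (at x within {0..X})"
      unfolding U_def[abs_def] by (rule sub) (rule derivative_eq_intros D refl | simp add: algebra_simps)+
    show "(U d d' has_real_derivative U d1 d1' x) (at x within {0..X})"
      unfolding U_def[abs_def] by (rule sub) (rule derivative_eq_intros D refl | simp)+
    show "(U d1 d1' has_real_derivative z * U c c' x - h x * U d d' x) (at x within {0..X})"
      unfolding U_def[abs_def] by (rule sub) (rule derivative_eq_intros D refl | simp add: algebra_simps)+
  qed
  have "\<exists>x\<in>{0..X}. U c c' x \<noteq> 0 \<or> U d d' x \<noteq> 0"
  proof (rule ccontr)
    assume "\<not> ?thesis"
    then have 0: "U c c' x = 0" "U d d' x = 0" if "x \<in> {0..X}" for x using that by auto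
    have X0: "0 \<in> {0..X}" using X by simp
    have const: "(f has_real_derivative 0) (at 0 within {0..X})" if "\<And>x. x \<in> {0..X} \<Longrightarrow> f x = 0" for f
      by (rule has_field_derivative_transform_within[OF DERIV_const[of 0] zero_less_one X0]) (use that in auto)
    have "U c1 c1' 0 = 0" "U d1 d1' 0 = 0"
      using has_real_derivative_unique_Icc[OF der(1)[OF X0] const[OF 0(1)] X(1) X0]
        has_real_derivative_unique_Icc[OF der(3)[OF X0] const[OF 0(2)] X(1) X0] by auto
    then show False using nz init by (simp add: U_def p0)
  qed
  moreover have "solves_N g h X z (U c c') (U d d')"
    unfolding solves_N_def
    by (rule exI[of _ "U c1 c1'"], rule exI[of _ "\<lambda>x. - (z * U d d' x) - g x * U c c' x"],
        rule exI[of _ "U d1 d1'"], rule exI[of _ "\<lambda>x. z * U c c' x - h x * U d d' x"])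
       (use der in auto)
  moreover have "U c c' 0 = 0" "U d d' 0 = 0" "U c c' X = 0" "U d d' X = 0"
    using uX vX zero by (simp_all add: U_def p0)
  ultimately show ?thesis unfolding dirichlet_eigenvalue_def by blast
qed

text \<open>The pair \<open>(v, -u)\<close> solves the system with the potentials exchanged and the same \<open>z\<close>.\<close>

lemma dirichlet_eigenvalue_swap:
  assumes "dirichlet_eigenvalue h g X z"
  shows "dirichlet_eigenvalue g h X z"
proof -
  obtain u v where uv: "solves_N h g X z u v" "u 0 = 0" "v 0 = 0" "u X = 0" "v X = 0"
    "\<exists>x\<in>{0..X}. u x \<noteq> 0 \<or> v x \<noteq> 0"
    using assms unfolding dirichlet_eigenvalue_def by blast
  obtain u1 u2 v1 v2 where D: "\<forall>x\<in>{0..X}.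
        (u has_real_derivative u1 x) (at x within {0..X}) \<and>
        (u1 has_real_derivative u2 x) (at x within {0..X}) \<and>
        (v has_real_derivative v1 x) (at x within {0..X}) \<and>
        (v1 has_real_derivative v2 x) (at x within {0..X}) \<and>
        - (- v2 x - g x * v x) = z * u x \<and>
        - u2 x - h x * u x = z * v x"
    using uv(1) unfolding solves_N_def by blast
  have "solves_N g h X z v (\<lambda>x. - u x)"
    unfolding solves_N_def
    by (rule exI[of _ v1], rule exI[of _ v2], rule exI[of _ "\<lambda>x. - u1 x"], rule exI[of _ "\<lambda>x. - u2 x"])
       (use D in \<open>auto intro!: derivative_eq_intros simp: algebra_simps\<close>)
  then show ?thesis
    unfolding dirichlet_eigenvalue_def
    using uv(2-6) by (intro exI[of _ v] exI[of _ "\<lambda>x. - u x"]) auto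
qed

text \<open>Here \<open>w\<close> is a kernel element and \<open>y\<close> its preimage under \<open>L\<^sub>+\<close>, while \<open>p\<close>, \<open>k\<close>, \<open>t\<close> are the coefficients of
\<open>v\<^sub>1\<close>, \<open>u\<^sub>2\<close>, \<open>v\<^sub>2\<close> that enter the second \<open>z\<close>-derivative of the determinant. By uniqueness \<open>w\<close> is a multiple of
\<open>b\<close>, and \<open>y\<close> is the same multiple of \<open>k\<close> plus the multiple of \<open>a\<close> that makes it vanish at \<open>l\<close>.\<close>

lemma kernel_pairing:
  assumes l: "0 < l" and g: "continuous_on {0..l} g" and h: "continuous_on {0..l} h"
    and a: "ode_solution l g (\<lambda>_. 0) a a1" "a 0 = 0" "a1 0 = 1"
    and b: "ode_solution l h (\<lambda>_. 0) b b1" "b 0 = 0" "b1 0 = 1" "b l = 0"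
    and p: "ode_solution l h a p p1" "p 0 = 0" "p1 0 = 0"
    and k: "ode_solution l g (\<lambda>x. - b x) k k1" "k 0 = 0" "k1 0 = 0"
    and t: "ode_solution l h k t t1" "t 0 = 0" "t1 0 = 0"
    and w: "ode_solution l h (\<lambda>_. 0) w w1" "w 0 = 0"
    and y: "ode_solution l g (\<lambda>x. - w x) y y1" "y 0 = 0" "y l = 0"
  shows "a l * b1 l * integral {0..l} (\<lambda>x. y x * w x) = (w1 l)\<^sup>2 * (k l * p l - a l * t l)"
proof -
  have ll: "l \<in> {0..l}" using l by simp
  define \<gamma> where "\<gamma> = w1 0"
  have w_eq: "w x = \<gamma> * b x" "w1 x = \<gamma> * b1 x" if "x \<in> {0..l}" for x
    using ode_solution_multiple[OF h w b(1-3) that] by (simp_all add: \<gamma>_def)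
  have diff: "ode_solution l g (\<lambda>_. 0) (\<lambda>x. y x - \<gamma> * k x) (\<lambda>x. y1 x - \<gamma> * k1 x)"
    by (rule ode_solution_cong_rhs[OF ode_solution_diff[OF y(1) k(1)]]) (simp add: w_eq)
  have y_eq: "y x = \<gamma> * k x + y1 0 * a x" if "x \<in> {0..l}" for x
    using ode_solution_multiple(1)[OF g diff _ a that] y(2) k(2,3) by simp
  \<comment> \<open>\<open>\<langle>k, b\<rangle>\<close> and \<open>\<langle>a, b\<rangle>\<close> are boundary terms, since \<open>k\<close> and \<open>a\<close> are images of \<open>t\<close> and \<open>p\<close>
  under the operator that annihilates \<open>b\<close>.\<close>
  have kb: "((\<lambda>x. k x * b x) has_integral - t l * b1 l) {0..l}"
    using lagrange_identity[OF t(1) b(1) ll] t b by simp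
  have ab: "((\<lambda>x. a x * b x) has_integral - p l * b1 l) {0..l}"
    using lagrange_identity[OF p(1) b(1) ll] p b by simp
  have "((\<lambda>x. \<gamma> * \<gamma> * (k x * b x) + y1 0 * \<gamma> * (a x * b x)) has_integral
      \<gamma> * \<gamma> * (- t l * b1 l) + y1 0 * \<gamma> * (- p l * b1 l)) {0..l}"
    by (intro has_integral_add has_integral_mult_right kb ab)
  then have "((\<lambda>x. y x * w x) has_integral
      \<gamma> * \<gamma> * (- t l * b1 l) + y1 0 * \<gamma> * (- p l * b1 l)) {0..l}"
    by (rule has_integral_eq[rotated]) (simp add: y_eq w_eq algebra_simps)
  then have int: "integral {0..l} (\<lambda>x. y x * w x) = \<gamma> * \<gamma> * (- t l * b1 l) + y1 0 * \<gamma> * (- p l * b1 l)"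
    by (simp add: has_integral_iff)
  have "y1 0 * a l = - \<gamma> * k l" using y_eq[OF ll] y(3) by simp
  moreover have "a l * b1 l * (\<gamma> * \<gamma> * (- t l * b1 l) + y1 0 * \<gamma> * (- p l * b1 l)) =
      (\<gamma> * b1 l)\<^sup>2 * - (a l * t l) + b1 l * b1 l * \<gamma> * (- p l) * (y1 0 * a l)"
    by (simp add: algebra_simps power2_eq_square)
  ultimately show ?thesis unfolding int w_eq(2)[OF ll]
    by (simp add: algebra_simps power2_eq_square)
qed

text \<open>The implicit function theorem for the characteristic determinant at \<open>(l, 0)\<close>, in the case that only the
second potential has a nontrivial Dirichlet solution on \<open>[0,l]\<close>. The formula for the second derivative is stated without
division so that it applies to \<open>w = 0\<close> as well.\<close>

lemma eigenvalue_curve: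
  assumes l: "0 < l" "l < L"
    and g: "continuous_on {0..L} g" and h: "continuous_on {0..L} h"
    and a: "ode_solution L g (\<lambda>_. 0) a a1" "a 0 = 0" "a1 0 = 1" "a l \<noteq> 0"
    and b: "ode_solution L h (\<lambda>_. 0) b b1" "b 0 = 0" "b1 0 = 1" "b l = 0"
  obtains r s where "0 < r" "smooth_relative_to {0..L} g h r s" "s 0 = 1"
    "\<And>z. \<bar>z\<bar> < r \<Longrightarrow> 0 < s z \<and> s z * l \<le> L \<and> dirichlet_eigenvalue g h (s z * l) z"
    "deriv s 0 = 0"
    "\<And>w w1 y y1. ode_solution l h (\<lambda>_. 0) w w1 \<Longrightarrow> w 0 = 0 \<Longrightarrow>
       ode_solution l g (\<lambda>x. - w x) y y1 \<Longrightarrow> y 0 = 0 \<Longrightarrow> y l = 0 \<Longrightarrow>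
       deriv (deriv s) 0 * (w1 l)\<^sup>2 = 2 / l * integral {0..l} (\<lambda>x. y x * w x)"
proof -
  have L: "0 \<le> L" using l by simp
  obtain R1 c c1 d d1 where R1: "0 < R1" "forced_family L g (-1) R1 c c1 d" "forced_family L h 1 R1 d d1 c"
    and i1: "\<And>n. c n 0 = 0" "\<And>n. d n 0 = 0" "\<And>n. c1 n 0 = (if n = 0 then 1 else 0)"
      "\<And>n. d1 n 0 = (if n = 0 then 0 else 0)"
    by (rule coupled_families_exist[OF g h L, of 1 0], rule that)
  obtain R2 c' c1' d' d1' where R2: "0 < R2" "forced_family L g (-1) R2 c' c1' d'" "forced_family L h 1 R2 d' d1' c'"
    and i2: "\<And>n. c' n 0 = 0" "\<And>n. d' n 0 = 0" "\<And>n. c1' n 0 = (if n = 0 then 0 else 0)"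
      "\<And>n. d1' n 0 = (if n = 0 then 1 else 0)"
    by (rule coupled_families_exist[OF g h L, of 0 1], rule that)
  define R where "R = min R1 R2"
  have R: "0 < R" using R1 R2 by (simp add: R_def)
  have F: "forced_family L g (-1) R c c1 d" "forced_family L h 1 R d d1 c"
    "forced_family L g (-1) R c' c1' d'" "forced_family L h 1 R d' d1' c'"
    using R1 R2 by (auto intro: forced_family_mono simp: R_def)
  note ode = F[unfolded forced_family_def, THEN conjunct2, THEN conjunct2, rule_format]
  have fam: "differentiable_family {0..L} R c c1" "differentiable_family {0..L} R d d1"
    "differentiable_family {0..L} R c' c1'" "differentiable_family {0..L} R d' d1'"
    using F by (auto simp: forced_family_def)
  note fam1 = forced_family_second_derivative[OF g F(1)] forced_family_second_derivative[OF h F(2)]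
    forced_family_second_derivative[OF g F(3)] forced_family_second_derivative[OF h F(4)]

  \<comment> \<open>At \<open>z = 0\<close> the system decouples, which determines the coefficients of low order.\<close>
  have hom: "ode_solution L g (\<lambda>_. 0) (c 0) (c1 0)" "ode_solution L h (\<lambda>_. 0) (d 0) (d1 0)"
    "ode_solution L g (\<lambda>_. 0) (c' 0) (c1' 0)" "ode_solution L h (\<lambda>_. 0) (d' 0) (d1' 0)"
    using ode[of 0] by (simp_all add: shift_coeffs_def)
  have c0: "c 0 x = a x" "c1 0 x = a1 x" and d0: "d 0 x = 0" "d1 0 x = 0"
    and c0': "c' 0 x = 0" "c1' 0 x = 0" and d0': "d' 0 x = b x" "d1' 0 x = b1 x" if "x \<in> {0..L}" for x
    using ode_solution_multiple[OF g hom(1) i1(1) a(1-3) that] i1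
      ode_solution_homogeneous_zero[OF h hom(2) i1(2) _ that]
      ode_solution_homogeneous_zero[OF g hom(3) i2(1) _ that]
      ode_solution_multiple[OF h hom(4) i2(2) b(1-3) that] i2
    by auto
  have ode1: "ode_solution L g (\<lambda>_. 0) (c 1) (c1 1)" "ode_solution L h a (d 1) (d1 1)"
    "ode_solution L g (\<lambda>x. - b x) (c' 1) (c1' 1)" "ode_solution L h (\<lambda>_. 0) (d' 1) (d1' 1)"
    "ode_solution L h (c' 1) (d' 2) (d1' 2)"
    using ode[of 1] ode(4)[of 2] 
    by (auto elim!: ode_solution_cong_rhs simp: shift_coeffs_def c0 d0 c0' d0' numeral_2_eq_2)
  have c1_0: "c 1 x = 0" and d1_0': "d' 1 x = 0" if "x \<in> {0..L}" for x
    using ode_solution_homogeneous_zero(1)[OF g ode1(1) i1(1) _ that] i1(3)[of 1]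
      ode_solution_homogeneous_zero(1)[OF h ode1(4) i2(2) _ that] i2(4)[of 1] by auto

  \<comment> \<open>The characteristic determinant and its two partial derivatives, as functions of \<open>(x, z)\<close>.\<close>
  define E where "E f p = param_series f (fst p) (snd p)" for f and p :: "real \<times> real"
  define \<Delta> where "\<Delta> p = E c p * E d' p - E c' p * E d p" for p
  define \<Delta>x where "\<Delta>x p = E c1 p * E d' p + E c p * E d1' p - (E c1' p * E d p + E c' p * E d1 p)" for p
  define \<Delta>z where "\<Delta>z p = E (diff_coeffs c) p * E d' p + E c p * E (diff_coeffs d') p
      - (E (diff_coeffs c') p * E d p + E c' p * E (diff_coeffs d) p)" for p
  define U where "U = {0<..<L} \<times> {-R<..<R}"
  have U: "open U" "U \<subseteq> {0..L} \<times> {-R<..<R}" by (auto simp: U_def open_Times)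
  have cont: "continuous_on U (E f)" if "differentiable_family {0..L} R f f1" for f f1
    unfolding E_def[abs_def] using continuous_on_subset[OF param_series_continuous_on[OF _ that] U(2)] by simp
  have derE: "(E f has_derivative (\<lambda>k. E f1 p * fst k + E (diff_coeffs f) p * snd k)) (at p)"
    if "differentiable_family {0..L} R f f1" "p \<in> U" for f f1 p
  proof -
    have "((\<lambda>p. param_series f (fst p) (snd p)) has_derivative
          (\<lambda>k. param_series f1 (fst p) (snd p) * fst k + param_series (diff_coeffs f) (fst p) (snd p) * snd k))
          (at (fst p, snd p) within {0..L} \<times> {-R<..<R})"
      using that U(2) by (intro param_series_has_derivative) (auto simp: U_def)
    then have "(E f has_derivative (\<lambda>k. E f1 p * fst k + E (diff_coeffs f) p * snd k)) (at p within U)"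
      unfolding E_def[abs_def] using has_derivative_subset[OF _ U(2)] by simp
    then show ?thesis using at_within_open[OF that(2) U(1)] by simp
  qed
  have der: "(\<Delta> has_derivative (\<lambda>k. \<Delta>x p * fst k + \<Delta>z p * snd k)) (at p)" if "p \<in> U" for p
    unfolding \<Delta>_def[abs_def]
    by (rule has_derivative_eq_rhs)
       (rule has_derivative_diff has_derivative_mult derE fam that
          | simp add: fun_eq_iff \<Delta>x_def \<Delta>z_def algebra_simps)+
  have contx: "continuous_on U \<Delta>x"
    unfolding \<Delta>x_def[abs_def] by (intro continuous_intros cont[OF fam(1)] cont[OF fam(2)] cont[OF fam(3)]
        cont[OF fam(4)] cont[OF fam1(1)] cont[OF fam1(2)] cont[OF fam1(3)] cont[OF fam1(4)])
  have contz: "continuous_on U \<Delta>z"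
    unfolding \<Delta>z_def[abs_def] by (intro continuous_intros cont[OF fam(1)] cont[OF fam(2)] cont[OF fam(3)]
        cont[OF fam(4)] fam[THEN differentiable_family_diff_coeffs, THEN cont])
  have lL: "l \<in> {0..L}" using l by simp
  have l0: "(l, 0) \<in> U" using l R by (simp add: U_def)
  have E0: "E f (x, 0) = f 0 x" for f x by (simp add: E_def)
  have diff_coeffs0: "diff_coeffs f 0 l = f 1 l" "diff_coeffs f 1 l = 2 * f 2 l" for f by (simp_all add: diff_coeffs_def numeral_2_eq_2)
  have \<Delta>0: "\<Delta> (l, 0) = 0" by (simp add: \<Delta>_def E0 d0'[OF lL] d0[OF lL] b)
  have \<Delta>z0: "\<Delta>z (l, 0) = 0"
    by (simp add: \<Delta>z_def E0 diff_coeffs0 d0'[OF lL] d0[OF lL] c0'[OF lL] d1_0'[OF lL] b del: One_nat_def)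
  have b1l: "b1 l \<noteq> 0"
  proof
    assume "b1 l = 0"
    have "b x = 0" if "x \<in> {0..l}" for x
      using ode_solution_double_zero[OF continuous_on_subset[OF h] ode_solution_restrict[OF b(1)] b(2,4) \<open>b1 l = 0\<close> that]
        l by auto
    then have "(b has_real_derivative 0) (at 0 within {0..l})"
      using l by (intro has_field_derivative_transform_within[OF DERIV_const[of 0] zero_less_one]) auto
    moreover have "(b has_real_derivative b1 0) (at 0 within {0..l})"
      using ode_solution_restrict[OF b(1), of l] l unfolding ode_solution_def by auto
    ultimately show False using has_real_derivative_unique_Icc[of b 0 0 0 l "b1 0"] l b(3) by auto
  qed
  have \<Delta>x0: "\<Delta>x (l, 0) = a l * b1 l"
    by (simp add: \<Delta>x_def E0 c0[OF lL] d0'[OF lL] d0[OF lL] c0'[OF lL] b)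
  obtain r X where r: "0 < r" and X0: "X 0 = l"
    and X: "\<And>z. \<bar>z\<bar> < r \<Longrightarrow> (X z, z) \<in> U \<and> \<Delta> (X z, z) = 0 \<and> \<Delta>x (X z, z) \<noteq> 0 \<and>
        (X has_real_derivative - \<Delta>z (X z, z) / \<Delta>x (X z, z)) (at z)"
    by (rule implicit_function_real[OF U(1) l0 der contx contz \<Delta>0])
       (use \<Delta>x0 a(4) b1l in auto)
  let ?T = "{-r<..<r}"
  have Tr: "\<bar>z\<bar> < r" if "z \<in> ?T" for z
    using that by auto
  have XL: "0 < X z" "X z < L" "\<bar>z\<bar> < R" if "z \<in> ?T" for z
    using X[OF Tr[OF that]] by (auto simp: U_def)
  have rR: "r \<le> R"
  proof (rule ccontr)
    assume "\<not> r \<le> R"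
    then show False using XL(3)[of R] R by auto
  qed
  have XT: "(X has_real_derivative - \<Delta>z (X z, z) / \<Delta>x (X z, z)) (at z within ?T)" if "z \<in> ?T" for z
    using X[OF Tr[OF that]] by (auto intro: has_field_derivative_at_within)

  \<comment> \<open>Bootstrapping: if \<open>X\<close> is \<open>C\<^sup>j\<close>, the series along \<open>X\<close> are \<open>C\<^sup>j\<close>, hence so is \<open>X' = - \<Delta>z / \<Delta>x\<close>. It stops
  at \<open>j = k + 2\<close> because the series gain only one derivative over the potentials.\<close>
  have smooth: "Ck_on (k + 2) ?T X" if gk: "Ck_on k {0..L} g" "Ck_on k {0..L} h" for k
  proof -
    have "j \<le> k + 2 \<Longrightarrow> Ck_on j ?T X" for j
    proof (induction j)
      case 0
      show ?case unfolding Ck_on.simps by (rule DERIV_continuous_on[OF XT])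
    next
      case (Suc j)
      have XC: "Ck_on j ?T X" using Suc by simp
      have gh: "Ck_on i {0..L} g \<and> Ck_on i {0..L} h" if "Suc i \<le> j" for i
        using Ck_on_mono[OF gk(1), of i] Ck_on_mono[OF gk(2), of i] Suc.prems that by simp
      have Xim: "X z \<in> {0..L}" if "z \<in> ?T" for z using XL[OF that] by simp
      note C1 = coupled_families_Ck_along[OF g h F(1,2) Xim rR XC gh]
        and C2 = coupled_families_Ck_along[OF g h F(3,4) Xim rR XC gh]
      have C: "Ck_on j ?T (\<lambda>z. E f (X z, z))"
        if "f \<in> {c, c1, d, d1, c', c1', d', d1', diff_coeffs c, diff_coeffs d, diff_coeffs c', diff_coeffs d'}" for f
        using that C1[of 0] C2[of 0] C1[of 1] C2[of 1] by (auto simp: E_def)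
      have "Ck_on j ?T (\<lambda>z. - \<Delta>z (X z, z) / \<Delta>x (X z, z))"
      proof (rule Ck_on_divide)
        show "Ck_on j ?T (\<lambda>z. - \<Delta>z (X z, z))"
          unfolding \<Delta>z_def by (intro Ck_on_minus Ck_on_diff Ck_on_add) (rule Ck_on_mult; rule C; simp)+
        show "Ck_on j ?T (\<lambda>z. \<Delta>x (X z, z))"
          unfolding \<Delta>x_def by (intro Ck_on_diff Ck_on_add) (rule Ck_on_mult; rule C; simp)+
        show "\<Delta>x (X z, z) \<noteq> 0" if "z \<in> ?T" for z using X[OF Tr[OF that]] by auto
      qed
      then show ?case using XT by (rule Ck_on_SucI[rotated])
    qed
    then show ?thesis by blast
  qed

  define s where "s z = X z / l" for z
  have ds: "(s has_real_derivative - \<Delta>z (X z, z) / \<Delta>x (X z, z) / l) (at z)" if "\<bar>z\<bar> < r" for z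
    unfolding s_def[abs_def] using DERIV_cdivide X[OF that] by blast
  then have deriv_s: "deriv s z = - \<Delta>z (X z, z) / \<Delta>x (X z, z) / l" if "\<bar>z\<bar> < r" for z
    using DERIV_imp_deriv that by blast
  have X'0: "(X has_real_derivative 0) (at 0)" using X[of 0] r X0 \<Delta>z0 by simp
  have dE: "((\<lambda>z. E f (X z, z)) has_real_derivative diff_coeffs f 0 l) (at 0)"
    if "differentiable_family {0..L} R f f1" for f f1
  proof -
    have "((\<lambda>z. param_series f (X z) z) has_real_derivative param_series f1 (X 0) 0 * 0 + param_series (diff_coeffs f) (X 0) 0 * 1) (at 0 within ?T)"
    proof (rule param_series_differentiable_along[OF _ that has_field_derivative_at_within[OF X'0] DERIV_ident])
      show "X t \<in> {0..L} \<and> \<bar>t\<bar> < R" if "t \<in> ?T" for t using XL[OF that] by simp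
    qed (use r in auto)
    then show ?thesis using r by (simp add: E_def X0 at_within_open[of 0 ?T])
  qed
  note dE' = dE[OF fam(1)] dE[OF fam(2)] dE[OF fam(3)] dE[OF fam(4)]
    fam[THEN differentiable_family_diff_coeffs, THEN dE] dE[OF fam1(1)] dE[OF fam1(2)] dE[OF fam1(3)] dE[OF fam1(4)]
  \<comment> \<open>\<open>\<kappa>\<close> is \<open>\<Delta>zz (l, 0)\<close>; as \<open>X' 0 = 0\<close>, the other second derivatives of \<open>\<Delta>\<close> do not contribute.\<close>
  define \<kappa> where "\<kappa> = 2 * (a l * d' 2 l - c' 1 l * d 1 l)"
  have dN: "((\<lambda>z. \<Delta>z (X z, z)) has_real_derivative \<kappa>) (at 0)"
    unfolding \<Delta>z_def
    by (rule derivative_eq_intros dE' refl)+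
       (simp add: X0 E0 diff_coeffs0 \<kappa>_def c0[OF lL] d0[OF lL] c0'[OF lL] d0'[OF lL] c1_0[OF lL] d1_0'[OF lL] b
          algebra_simps del: One_nat_def)
  have "\<exists>M. ((\<lambda>z. \<Delta>x (X z, z)) has_real_derivative M) (at 0)"
    unfolding \<Delta>x_def by (rule exI) (rule derivative_eq_intros dE' refl)+
  then obtain M where dM: "((\<lambda>z. \<Delta>x (X z, z)) has_real_derivative M) (at 0)" ..
  have "((\<lambda>z. - \<Delta>z (X z, z) / \<Delta>x (X z, z) / l) has_real_derivative
      (- \<kappa> * \<Delta>x (X 0, 0) - - \<Delta>z (X 0, 0) * M) / (\<Delta>x (X 0, 0) * \<Delta>x (X 0, 0)) / l) (at 0)"
    by (intro DERIV_cdivide DERIV_divide DERIV_minus dN dM) (use X[of 0] r in auto)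
  then have "((\<lambda>z. - \<Delta>z (X z, z) / \<Delta>x (X z, z) / l) has_real_derivative - \<kappa> / (a l * b1 l) / l) (at 0)"
    using a(4) b1l by (simp add: X0 \<Delta>x0 \<Delta>z0)
  then have "(deriv s has_real_derivative - \<kappa> / (a l * b1 l) / l) (at 0)"
    by (rule has_field_derivative_transform_within[OF _ r]) (auto simp: deriv_s dist_real_def)
  then have dds: "deriv (deriv s) 0 = - \<kappa> / (a l * b1 l) / l" by (rule DERIV_imp_deriv)

  show thesis
  proof (rule that[OF r])
    show "smooth_relative_to {0..L} g h r s"
      unfolding smooth_relative_to_def s_def[abs_def] using smooth l
      by (auto intro!: Ck_on_divide Ck_on_const simp del: Ck_on.simps add_2_eq_Suc')
    show "s 0 = 1" using X0 l by (simp add: s_def)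
    show "deriv s 0 = 0" using deriv_s[of 0] r \<Delta>z0 X0 by simp
    show "0 < s z \<and> s z * l \<le> L \<and> dirichlet_eigenvalue g h (s z * l) z" if z: "\<bar>z\<bar> < r" for z
    proof -
      have zT: "z \<in> ?T" using z by auto
      have "dirichlet_eigenvalue g h (X z) z"
        using X[OF z] XL[OF zT] i1 i2
        by (intro dirichlet_eigenvalue_if_singular[OF g h F]) (auto simp: \<Delta>_def E_def)
      then show ?thesis using XL[OF zT] l by (simp add: s_def)
    qed
    fix w w1 y y1
    assume w: "ode_solution l h (\<lambda>_. 0) w w1" "w 0 = 0"
      and y: "ode_solution l g (\<lambda>x. - w x) y y1" "y 0 = 0" "y l = 0"
    note res = ode_solution_restrict[where l=l and L=L, OF _ less_imp_le[OF l(2)]]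
    have "a l * b1 l * integral {0..l} (\<lambda>x. y x * w x) = (w1 l)\<^sup>2 * (c' 1 l * d 1 l - a l * d' 2 l)"
    proof (rule kernel_pairing[OF l(1) _ _ res[OF a(1)] a(2,3) res[OF b(1)] b(2-4) res[OF ode1(2)] _ _
          res[OF ode1(3)] _ _ res[OF ode1(5)] _ _ w y])
      show "continuous_on {0..l} g" "continuous_on {0..l} h"
        using l g h by (auto elim: continuous_on_subset)
    qed (use i1 i2 in auto)
    then have "a l * b1 l * integral {0..l} (\<lambda>x. y x * w x) = - (w1 l)\<^sup>2 * \<kappa> / 2"
      by (simp add: \<kappa>_def algebra_simps)
    then have "integral {0..l} (\<lambda>x. y x * w x) = - (w1 l)\<^sup>2 * \<kappa> / 2 / (a l * b1 l)"
      using a(4) b1l by (simp add: field_simps)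
    then show "deriv (deriv s) 0 * (w1 l)\<^sup>2 = 2 / l * integral {0..l} (\<lambda>x. y x * w x)"
      unfolding dds by (simp add: mult_ac)
  qed
qed

section \<open>The operators in \<open>L\<^sup>2\<close> and classical solutions\<close>

lemma finite_measure_Ioo: "finite_measure (lebesgue_on {0<..<l::real})"
  by (rule finite_measure_lebesgue_on) simp

lemma continuous_measurable_Ioo:
  fixes f :: "real \<Rightarrow> real"
  assumes "continuous_on {0..l} f"
  shows "f \<in> borel_measurable (lebesgue_on {0<..<l})"
proof -
  have "continuous_on {0<..<l} f" by (rule continuous_on_subset[OF assms]) auto
  then show ?thesis by (intro continuous_imp_measurable_on_sets_lebesgue) auto
qed

lemma continuous_integrable_Ioo:
  fixes f :: "real \<Rightarrow> real"
  assumes "continuous_on {0..l} f"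
  shows "integrable (lebesgue_on {0<..<l}) f"
proof -
  obtain B where B: "\<forall>x\<in>{0..l}. \<bar>f x\<bar> \<le> B" using continuous_on_Icc_bounded[OF assms] by blast
  show ?thesis
    by (rule finite_measure.integrable_const_bound[where B=B, OF finite_measure_Ioo _ continuous_measurable_Ioo[OF assms]])
       (use B in \<open>auto intro!: AE_I2 simp: space_restrict_space\<close>)
qed

lemma continuous_in_L2: "continuous_on {0..l} f \<Longrightarrow> f \<in> L2 l"
  unfolding L2_def
  by (auto intro!: continuous_measurable_Ioo continuous_integrable_Ioo continuous_on_power)

lemma integrable_if_L2:
  assumes "f \<in> L2 l"
  shows "integrable (lebesgue_on {0<..<l}) f"
proof (rule Bochner_Integration.integrable_bound)
  show "integrable (lebesgue_on {0<..<l}) (\<lambda>x. 1 + (f x)\<^sup>2)"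
    using assms continuous_integrable_Ioo[of l "\<lambda>_. 1"]
    by (intro Bochner_Integration.integrable_add) (auto simp: L2_def)
  show "f \<in> borel_measurable (lebesgue_on {0<..<l})" using assms by (simp add: L2_def)
  \<comment> \<open>The function \<open>1 + f\<^sup>2\<close> dominates \<open>\<bar>f\<bar>\<close> and is integrable, the interval being bounded.\<close>
  have "\<bar>x\<bar> \<le> 1 + x\<^sup>2" for x :: real
    using zero_le_power2[of "\<bar>x\<bar> - 1"] by (simp add: power2_eq_square algebra_simps)
  then show "AE x in lebesgue_on {0<..<l}. norm (f x) \<le> norm (1 + (f x)\<^sup>2)"
    by (intro AE_I2) (simp add: abs_of_nonneg add_nonneg_nonneg)
qed

lemma integrable_Ioo_subset:
  fixes f :: "real \<Rightarrow> real"
  assumes "integrable (lebesgue_on {0<..<l}) f" "x \<le> l"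
  shows "integrable (lebesgue_on {0<..<x}) f"
proof -
  have "set_integrable lebesgue {0<..<l} f"
    using assms(1) integrable_restrict_space[of "{0<..<l}" lebesgue f] by (simp add: set_integrable_def)
  then have "set_integrable lebesgue {0<..<x} f"
    by (rule set_integrable_subset) (use assms(2) in auto)
  then show ?thesis
    using integrable_restrict_space[of "{0<..<x}" lebesgue f] by (simp add: set_integrable_def)
qed

lemma lint_eq_integral:
  fixes f :: "real \<Rightarrow> real"
  assumes "integrable (lebesgue_on {0<..<l}) f" "x \<le> l"
  shows "(LINT t|lebesgue_on {0<..<x}. f t) = integral {0..x} f"
  using lebesgue_integral_eq_integral[OF integrable_Ioo_subset[OF assms]]
  by (simp add: integral_open_interval_real)

lemma l2_inner_continuous:
  assumes "continuous_on {0..l} f" "continuous_on {0..l} k"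
  shows "l2_inner l f k = integral {0..l} (\<lambda>x. f x * k x)"
  unfolding l2_inner_def
  by (rule lint_eq_integral[OF continuous_integrable_Ioo]) (auto intro!: continuous_intros assms)

lemma H1_deriv_integral:
  assumes "H1_deriv l f f'"
  shows "continuous_on {0..l} f"
    and "\<And>x. x \<in> {0..l} \<Longrightarrow> f x = f 0 + integral {0..x} f'"
proof -
  have int: "integrable (lebesgue_on {0<..<l}) f'"
    using assms by (intro integrable_if_L2) (simp add: H1_deriv_def)
  show eq: "f x = f 0 + integral {0..x} f'" if "x \<in> {0..l}" for x
  proof -
    have "f x = f 0 + (LINT t|lebesgue_on {0<..<x}. f' t)"
      using assms that unfolding H1_deriv_def by blast
    also have "(LINT t|lebesgue_on {0<..<x}. f' t) = integral {0..x} f'"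
      using that by (intro lint_eq_integral[OF int]) simp
    finally show ?thesis .
  qed
  have "f' integrable_on {0..l}"
    using integrable_on_lebesgue_on[OF int] by (simp add: integrable_on_open_interval_real)
  then have "continuous_on {0..l} (\<lambda>x. f 0 + integral {0..x} f')"
    by (intro continuous_on_add continuous_on_const indefinite_integral_continuous_1)
  then show "continuous_on {0..l} f"
    by (rule continuous_on_eq) (simp only: eq[symmetric])
qed

lemma has_derivative_if_integral:
  fixes f f' :: "real \<Rightarrow> real"
  assumes "continuous_on {0..l} f'" "\<And>x. x \<in> {0..l} \<Longrightarrow> f x = f 0 + integral {0..x} f'" "x \<in> {0..l}"
  shows "(f has_real_derivative f' x) (at x within {0..l})"
proof (rule has_field_derivative_transform_within[OF _ zero_less_one assms(3)])
  show "((\<lambda>x. f 0 + integral {0..x} f') has_real_derivative f' x) (at x within {0..l})"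
    using DERIV_add[OF DERIV_const integral_has_real_derivative[OF assms(1,3)]] by simp
  show "f 0 + integral {0..t} f' = f t" if "t \<in> {0..l}" for t
    by (rule assms(2)[OF that, symmetric])
qed

lemma H1_deriv_if_derivative:
  assumes "\<And>x. x \<in> {0..l} \<Longrightarrow> (f has_real_derivative f' x) (at x within {0..l})" "continuous_on {0..l} f'"
  shows "H1_deriv l f f'"
  unfolding H1_deriv_def
proof (intro conjI ballI continuous_in_L2[OF assms(2)])
  fix x assume x: "x \<in> {0..l}"
  have "integral {0..x} f' = f x - f 0"
    using has_derivative_within_imp_integral[OF assms(1) x] by (simp add: has_integral_iff)
  then show "f x = f 0 + (LINT t|lebesgue_on {0<..<x}. f' t)"
    using lint_eq_integral[OF continuous_integrable_Ioo[OF assms(2)], of x] x by simp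
qed

text \<open>Regularity: the weak derivatives \<open>f1\<close>, \<open>f2\<close> of \<open>f\<close> satisfy \<open>f2 = - w - q f\<close> almost everywhere. The right-hand
side is continuous, so \<open>f1\<close>, being its integral, is continuously differentiable.\<close>

lemma schrodinger_imp_classical:
  assumes q: "continuous_on {0..l} q" and w: "continuous_on {0..l} w"
    and f: "(f, w) \<in> schrodinger l q" and l: "0 < l"
  obtains f1 where "ode_solution l q (\<lambda>x. - w x) f f1" "f 0 = 0" "f l = 0" "\<And>x. x \<notin> {0..l} \<Longrightarrow> f x = 0"
proof -
  obtain f1 f2 where f1: "H1_deriv l f f1" and f2: "H1_deriv l f1 f2"
    and ae: "AE x in lebesgue_on {0<..<l}. w x = - f2 x - q x * f x"
    using f by (auto simp: schrodinger_def)
  define k where "k x = - w x - q x * f x" for x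
  note cont = H1_deriv_integral(1)[OF f1] H1_deriv_integral(1)[OF f2]
  have k: "continuous_on {0..l} k" unfolding k_def by (intro continuous_intros w q cont)
  have "f1 x = f1 0 + integral {0..x} k" if x: "x \<in> {0..l}" for x
  proof -
    have sub: "{0<..<x} \<subseteq> {0<..<l}" using x by auto
    have "AE t in lebesgue_on {0<..<x}. f2 t = k t"
      using ae sub unfolding k_def
      by (simp add: AE_restrict_space_iff) (auto elim!: eventually_mono)
    moreover have "f2 \<in> borel_measurable (lebesgue_on {0<..<x})"
      using f2 measurable_restrict_mono[OF _ sub] by (auto simp: H1_deriv_def L2_def)
    moreover have "k \<in> borel_measurable (lebesgue_on {0<..<x})"
      by (rule measurable_restrict_mono[OF continuous_measurable_Ioo[OF k] sub])
    ultimately have "(LINT t|lebesgue_on {0<..<x}. f2 t) = (LINT t|lebesgue_on {0<..<x}. k t)"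
      by (intro integral_cong_AE)
    also have "\<dots> = integral {0..x} k"
      using lint_eq_integral[OF continuous_integrable_Ioo[OF k]] x by simp
    finally have "(LINT t|lebesgue_on {0<..<x}. f2 t) = integral {0..x} k" .
    moreover have "f1 x = f1 0 + (LINT t|lebesgue_on {0<..<x}. f2 t)"
      using f2 x unfolding H1_deriv_def by blast
    ultimately show ?thesis by (simp only:)
  qed
  then have "(f1 has_real_derivative k x) (at x within {0..l})" if "x \<in> {0..l}" for x
    using has_derivative_if_integral[OF k _ that] by blast
  moreover have "(f has_real_derivative f1 x) (at x within {0..l})" if "x \<in> {0..l}" for x
    by (rule has_derivative_if_integral[OF cont(2) H1_deriv_integral(2)[OF f1] that])
  ultimately have "ode_solution l q (\<lambda>x. - w x) f f1"
    unfolding ode_solution_def k_def by simp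
  moreover have "f 0 = 0" "f l = 0" "\<And>x. x \<notin> {0..l} \<Longrightarrow> f x = 0"
    using f by (auto simp: schrodinger_def H10_def H1_def)
  ultimately show thesis by (rule that)
qed

lemma classical_imp_schrodinger:
  assumes q: "continuous_on {0..l} q" and w: "continuous_on {0..l} w" and l: "0 < l"
    and y: "ode_solution l q (\<lambda>x. - w x) y y1" "y 0 = 0" "y l = 0"
  shows "(\<lambda>x. if x \<in> {0..l} then y x else 0, w) \<in> schrodinger l q"
proof -
  let ?f = "\<lambda>x. if x \<in> {0..l} then y x else 0"
  define y2 where "y2 x = - w x - q x * y x" for x
  have y12: "(y has_real_derivative y1 x) (at x within {0..l})" "(y1 has_real_derivative y2 x) (at x within {0..l})"
    if "x \<in> {0..l}" for x using y(1) that unfolding ode_solution_def y2_def by auto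
  note cont = ode_solution_continuous[OF y(1)]
  have y2: "continuous_on {0..l} y2" unfolding y2_def by (intro continuous_intros w q cont)
  have f: "H1_deriv l ?f y1"
  proof (rule H1_deriv_if_derivative[OF _ cont(2)])
    fix x assume x: "x \<in> {0..l}"
    show "(?f has_real_derivative y1 x) (at x within {0..l})"
      by (rule has_field_derivative_transform_within[OF y12(1)[OF x] zero_less_one x]) auto
  qed
  have f1: "H1_deriv l y1 y2" by (rule H1_deriv_if_derivative[OF y12(2) y2])
  have fH1: "?f \<in> H1 l" unfolding H1_def using f by auto
  have fH2: "?f \<in> H2 l" unfolding H2_def using fH1 f f1 by blast
  have fH10: "?f \<in> H10 l" unfolding H10_def using fH1 y(2,3) l by simp
  have ae: "AE x in lebesgue_on {0<..<l}. w x = - y2 x - q x * ?f x"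
    by (rule AE_I2) (auto simp: space_restrict_space y2_def)
  show ?thesis
    unfolding schrodinger_def using fH2 fH10 f f1 ae continuous_in_L2[OF w] by blast
qed

text \<open>Turns \<open>- L\<^sub>- v = u\<close> into \<open>L\<^sub>- (- v) = u\<close>, the form to which the result for exchanged potentials applies.\<close>

lemma schrodinger_uminus:
  assumes q: "continuous_on {0..l} q" and w: "continuous_on {0..l} w" and l: "0 < l"
    and f: "(f, w) \<in> schrodinger l q"
  shows "(- f, - w) \<in> schrodinger l q"
proof -
  obtain f1 where f1: "ode_solution l q (\<lambda>x. - w x) f f1" "f 0 = 0" "f l = 0" "\<And>x. x \<notin> {0..l} \<Longrightarrow> f x = 0"
    by (rule schrodinger_imp_classical[OF q w f l], rule that)
  have w': "continuous_on {0..l} (- w)" using w continuous_on_minus by (auto simp: fun_Compl_def)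
  have "ode_solution l q (\<lambda>x. - (- w) x) (- f) (- f1)"
    using f1(1) unfolding ode_solution_def fun_Compl_def
    by (auto intro!: derivative_eq_intros)
  from classical_imp_schrodinger[OF q w' l this]
  have "(\<lambda>x. if x \<in> {0..l} then (- f) x else 0, - w) \<in> schrodinger l q"
    using f1(2,3) by (simp add: fun_Compl_def)
  moreover have "(\<lambda>x. if x \<in> {0..l} then (- f) x else 0) = - f"
    using f1(4) by (auto simp: fun_eq_iff fun_Compl_def)
  ultimately show ?thesis by simp
qed

lemma ker_schrodinger_classical:
  assumes q: "continuous_on {0..l} q" and l: "0 < l" and f: "f \<in> ker (schrodinger l q)"
  obtains f1 where "ode_solution l q (\<lambda>_. 0) f f1" "f 0 = 0" "f l = 0" "\<And>x. x \<notin> {0..l} \<Longrightarrow> f x = 0"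
proof -
  have "continuous_on {0..l} (0 :: real \<Rightarrow> real)" unfolding zero_fun_def by simp
  moreover have "(f, 0) \<in> schrodinger l q" using f by (simp add: ker_def)
  ultimately show thesis
    by (rule schrodinger_imp_classical[OF q _ _ l, where w=0]) (use that in simp)
qed

lemma ker_schrodinger_trivial:
  assumes q: "continuous_on {0..l} q" and l: "0 < l"
    and a: "ode_solution l q (\<lambda>_. 0) a a1" "a 0 = 0" "a1 0 = 1" "a l \<noteq> 0"
    and f: "f \<in> ker (schrodinger l q)"
  shows "f = 0"
proof -
  obtain f1 where f1: "ode_solution l q (\<lambda>_. 0) f f1" "f 0 = 0" "f l = 0" "\<And>x. x \<notin> {0..l} \<Longrightarrow> f x = 0"
    by (rule ker_schrodinger_classical[OF q l f], rule that)
  note m = ode_solution_multiple(1)[OF q f1(1,2) a(1-3)]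
  have "f1 0 = 0" using m[of l] f1(3) a(4) l by simp
  then have "f x = 0" for x using m[of x] f1(4)[of x] by (cases "x \<in> {0..l}") auto
  then show ?thesis by (simp add: fun_eq_iff)
qed

lemma ker_schrodinger_nontrivial:
  assumes q: "continuous_on {0..l} q" and l: "0 < l"
    and b: "ode_solution l q (\<lambda>_. 0) b b1" "b 0 = 0" "b1 0 = 1" "b l = 0"
  obtains f where "f \<in> ker (schrodinger l q)" "f \<noteq> 0"
proof -
  let ?f = "\<lambda>x. if x \<in> {0..l} then b x else 0"
  have "(?f, 0) \<in> schrodinger l q"
    using b by (intro classical_imp_schrodinger[OF q _ l]) (auto simp: zero_fun_def)
  moreover have "?f \<noteq> 0"
  proof
    assume f0: "?f = 0"
    have "b x = 0" if "x \<in> {0..l}" for x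
      using fun_cong[OF f0, of x] that by (simp add: zero_fun_def)
    then have "(b has_real_derivative 0) (at 0 within {0..l})"
      using l by (intro has_field_derivative_transform_within[OF DERIV_const[of 0] zero_less_one]) auto
    moreover have "(b has_real_derivative b1 0) (at 0 within {0..l})"
      using b(1) l unfolding ode_solution_def by auto
    ultimately show False using has_real_derivative_unique_Icc[of b 0 0 0 l "b1 0"] l b(3) by auto
  qed
  ultimately show thesis using that by (simp add: ker_def)
qed

text \<open>If \<open>a l \<noteq> 0\<close>, a multiple of \<open>a\<close> corrects the boundary value at \<open>l\<close> of the solution with zero initial data.\<close>

lemma schrodinger_uniquely_solvable:
  assumes q: "continuous_on {0..l} q" and l: "0 < l" and w: "continuous_on {0..l} w"
    and a: "ode_solution l q (\<lambda>_. 0) a a1" "a 0 = 0" "a1 0 = 1" "a l \<noteq> 0"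
  shows "\<exists>!f. (f, w) \<in> schrodinger l q"
proof (rule ex_ex1I)
  have w': "continuous_on {0..l} (\<lambda>x. - w x)" by (intro continuous_intros w)
  obtain p p1 where p: "ode_solution l q (\<lambda>x. - w x) p p1" "p 0 = 0" "p1 0 = 0"
    by (rule ode_solution_exists[OF q less_imp_le[OF l] w'])
  let ?k = "p l / a l"
  have "ode_solution l q (\<lambda>x. - w x) (\<lambda>x. p x - ?k * a x) (\<lambda>x. p1 x - ?k * a1 x)"
    using ode_solution_diff[OF p(1) a(1), of ?k] by simp
  from classical_imp_schrodinger[OF q w l this] a p
  show "\<exists>f. (f, w) \<in> schrodinger l q" by auto
next
  fix f k assume "(f, w) \<in> schrodinger l q" "(k, w) \<in> schrodinger l q"
  obtain f1 where f: "ode_solution l q (\<lambda>x. - w x) f f1" "f 0 = 0" "f l = 0" "\<And>x. x \<notin> {0..l} \<Longrightarrow> f x = 0"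
    by (rule schrodinger_imp_classical[OF q w \<open>(f, w) \<in> schrodinger l q\<close> l], rule that)
  obtain k1 where k: "ode_solution l q (\<lambda>x. - w x) k k1" "k 0 = 0" "k l = 0" "\<And>x. x \<notin> {0..l} \<Longrightarrow> k x = 0"
    by (rule schrodinger_imp_classical[OF q w \<open>(k, w) \<in> schrodinger l q\<close> l], rule that)
  have d: "ode_solution l q (\<lambda>_. 0) (\<lambda>x. f x - 1 * k x) (\<lambda>x. f1 x - 1 * k1 x)"
    using ode_solution_diff[OF f(1) k(1), of 1] by simp
  have d0: "f 0 - 1 * k 0 = 0" using f k by simp
  note m = ode_solution_multiple(1)[OF q d d0 a(1-3)]
  have "f1 0 - 1 * k1 0 = 0" using m[of l] f(3) k(3) a(4) l by simp
  then have "f x = k x" for x using m[of x] f(4)[of x] k(4)[of x] by (cases "x \<in> {0..l}") auto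
  then show "f = k" by (simp add: fun_eq_iff)
qed

lemma ker_opN: "ker (opN l g h) = ker (schrodinger l g) \<times> ker (schrodinger l h)"
  by (auto simp: ker_def opN_def zero_prod_def)

lemma opN_simple_kernel:
  assumes l: "0 < l" and g: "continuous_on {0..l} g" and h: "continuous_on {0..l} h"
    and a: "ode_solution l g (\<lambda>_. 0) a a1" "a 0 = 0" "a1 0 = 1"
    and b: "ode_solution l h (\<lambda>_. 0) b b1" "b 0 = 0" "b1 0 = 1"
    and dim: "dim (ker (opN l g h)) = 1"
  shows "a l = 0 \<longleftrightarrow> b l \<noteq> 0"
proof -
  obtain B where B: "B \<subseteq> ker (opN l g h)" "independent B" "ker (opN l g h) \<subseteq> span B" "card B = 1"
    using basis_exists[of "ker (opN l g h)"] dim by metis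
  obtain e where e: "B = {e}" using B(4) card_1_singletonE by blast
  have e0: "e \<noteq> 0" using B(2) e dependent_zero by blast
  have "\<not> (a l \<noteq> 0 \<and> b l \<noteq> 0)"
  proof
    assume ab: "a l \<noteq> 0 \<and> b l \<noteq> 0"
    have "e \<in> ker (schrodinger l g) \<times> ker (schrodinger l h)"
      using B(1) unfolding e ker_opN by simp
    then have "fst e = 0" "snd e = 0"
      using ker_schrodinger_trivial[OF g l a] ker_schrodinger_trivial[OF h l b] ab
      by (auto simp only: mem_Times_iff)
    then have "e = 0" by (simp only: prod_eq_iff fst_zero snd_zero)
    then show False using e0 by simp
  qed
  moreover have "\<not> (a l = 0 \<and> b l = 0)"
  proof
    assume ab: "a l = 0 \<and> b l = 0"
    obtain u where u: "u \<in> ker (schrodinger l g)" "u \<noteq> 0"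
      using ker_schrodinger_nontrivial[OF g l a] ab by blast
    obtain v where v: "v \<in> ker (schrodinger l h)" "v \<noteq> 0"
      using ker_schrodinger_nontrivial[OF h l b] ab by blast
    \<comment> \<open>Then \<open>(u, 0)\<close> and \<open>(0, v)\<close> both belong to the kernel, but do not lie on one line.\<close>
    have 0: "0 \<in> ker (schrodinger l q)" if q: "continuous_on {0..l} q" for q
    proof -
      have "ode_solution l q (\<lambda>x. - 0) (\<lambda>_. 0) (\<lambda>_. 0)"
        by (simp add: ode_solution_def)
      from classical_imp_schrodinger[OF q continuous_on_const l this]
      have "(\<lambda>_. 0, \<lambda>_. 0) \<in> schrodinger l q" by simp
      then show ?thesis by (simp add: ker_def zero_fun_def)
    qed
    have "(u, 0) \<in> span {e}" "(0, v) \<in> span {e}"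
      using B(3) u(1) v(1) 0[OF g] 0[OF h] unfolding e ker_opN by blast+
    then obtain i j where ij: "(u, 0) = i *\<^sub>R e" "(0, v) = j *\<^sub>R e"
      by (auto simp: span_singleton)
    then have "i *\<^sub>R fst e = u" "j *\<^sub>R fst e = 0" "j *\<^sub>R snd e = v"
      by (metis fst_scaleR fst_conv, metis fst_scaleR fst_conv, metis snd_scaleR snd_conv)
    then show False using u(2) v(2) by (cases "j = 0") auto
  qed
  ultimately show ?thesis by blast
qed

text \<open>A nonzero kernel element has a nonzero slope at \<open>l\<close> by \<open>ode_solution_double_zero\<close>, so the identity for the
second derivative can be divided by its square.\<close>

lemma eigenvalue_curve_concavity:
  assumes l: "0 < l" "l < L"
    and g: "continuous_on {0..L} g" and h: "continuous_on {0..L} h"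
    and a: "ode_solution L g (\<lambda>_. 0) a a1" "a 0 = 0" "a1 0 = 1" "a l \<noteq> 0"
    and b: "ode_solution L h (\<lambda>_. 0) b b1" "b 0 = 0" "b1 0 = 1" "b l = 0"
  obtains r s where "0 < r" "smooth_relative_to {0..L} g h r s" "s 0 = 1"
    "\<And>z. \<bar>z\<bar> < r \<Longrightarrow> 0 < s z \<and> s z * l \<le> L \<and> dirichlet_eigenvalue g h (s z * l) z"
    "deriv s 0 = 0"
    "\<And>v. v \<in> ker (schrodinger l h) \<Longrightarrow> v \<noteq> 0 \<Longrightarrow>
       continuous_on {0..l} v \<and> vector_derivative v (at l within {0..l}) \<noteq> 0 \<and>
       (\<forall>y. (y, v) \<in> schrodinger l g \<longrightarrow> deriv (deriv s) 0 =
            2 / l * (l2_inner l y v / (vector_derivative v (at l within {0..l}))\<^sup>2))"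
proof (rule eigenvalue_curve[OF l g h a b])
  fix r s
  assume r: "0 < r" "smooth_relative_to {0..L} g h r s" "s 0 = 1"
    "\<And>z. \<bar>z\<bar> < r \<Longrightarrow> 0 < s z \<and> s z * l \<le> L \<and> dirichlet_eigenvalue g h (s z * l) z"
    "deriv s 0 = 0"
    and concave: "\<And>w w1 y y1. ode_solution l h (\<lambda>_. 0) w w1 \<Longrightarrow> w 0 = 0 \<Longrightarrow>
       ode_solution l g (\<lambda>x. - w x) y y1 \<Longrightarrow> y 0 = 0 \<Longrightarrow> y l = 0 \<Longrightarrow>
       deriv (deriv s) 0 * (w1 l)\<^sup>2 = 2 / l * integral {0..l} (\<lambda>x. y x * w x)"
  have gl: "continuous_on {0..l} g" and hl: "continuous_on {0..l} h"
    using l g h by (auto elim: continuous_on_subset)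
  show thesis
  proof (rule that[OF r], assumption)
    fix v assume v: "v \<in> ker (schrodinger l h)" "v \<noteq> 0"
    obtain v1 where v1: "ode_solution l h (\<lambda>_. 0) v v1" "v 0 = 0" "v l = 0" "\<And>x. x \<notin> {0..l} \<Longrightarrow> v x = 0"
      by (rule ker_schrodinger_classical[OF hl l(1) v(1)], rule that)
    note vc = ode_solution_continuous(1)[OF v1(1)]
    have "(v has_real_derivative v1 l) (at l within {0..l})"
      using v1(1) l unfolding ode_solution_def by auto
    then have vd: "vector_derivative v (at l within {0..l}) = v1 l"
      using l by (intro vector_derivative_within_closed_interval)
        (auto simp: has_real_derivative_iff_has_vector_derivative)
    have v1l: "v1 l \<noteq> 0"
    proof
      assume "v1 l = 0"
      then have "v x = 0" for x
        using ode_solution_double_zero[OF hl v1(1-3), of x] v1(4)[of x] by (cases "x \<in> {0..l}") auto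
      then show False using v(2) by (simp add: fun_eq_iff)
    qed
    have "deriv (deriv s) 0 = 2 / l * (l2_inner l y v / (v1 l)\<^sup>2)" if y: "(y, v) \<in> schrodinger l g" for y
    proof -
      obtain y1 where y1: "ode_solution l g (\<lambda>x. - v x) y y1" "y 0 = 0" "y l = 0" "\<And>x. x \<notin> {0..l} \<Longrightarrow> y x = 0"
        by (rule schrodinger_imp_classical[OF gl vc y l(1)], rule that)
      have "deriv (deriv s) 0 = deriv (deriv s) 0 * (v1 l)\<^sup>2 / (v1 l)\<^sup>2"
        using v1l by simp
      also have "\<dots> = 2 / l * integral {0..l} (\<lambda>x. y x * v x) / (v1 l)\<^sup>2"
        by (simp only: concave[OF v1(1,2) y1(1-3)])
      finally show ?thesis
        unfolding l2_inner_continuous[OF ode_solution_continuous(1)[OF y1(1)] vc] by simp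
    qed
    then show "continuous_on {0..l} v \<and> vector_derivative v (at l within {0..l}) \<noteq> 0 \<and>
       (\<forall>y. (y, v) \<in> schrodinger l g \<longrightarrow> deriv (deriv s) 0 =
            2 / l * (l2_inner l y v / (vector_derivative v (at l within {0..l}))\<^sup>2))"
      using vc v1l by (simp add: vd)
  qed
qed

theorem theorem2p9:
  fixes l l' :: real and g h :: "real \<Rightarrow> real"
  assumes "0 < l" and "l < l'"
    and "Ck_on 2 {0..l'} g" and "Ck_on 2 {0..l'} h"
    and "dim (ker (opN l g h)) = 1"
  shows "\<exists>r>0. \<exists>s :: real \<Rightarrow> real.
    smooth_relative_to {0..l'} g h r s \<and>
    s 0 = 1 \<and>
    (\<forall>z. \<bar>z\<bar> < r \<longrightarrow>
       0 < s z \<and> s z * l \<le> l' \<and> dirichlet_eigenvalue g h (s z * l) z) \<and>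
    deriv s 0 = 0 \<and>
    (\<forall>v. 0 \<in> Spec l (schrodinger l h) - Spec l (schrodinger l g) \<and>
         v \<in> ker (schrodinger l h) \<and> v \<noteq> 0 \<longrightarrow>
       vector_derivative v (at l within {0..l}) \<noteq> 0 \<and>
       (\<exists>!uh. (uh, v) \<in> schrodinger l g) \<and>
       (\<forall>uh. (uh, v) \<in> schrodinger l g \<longrightarrow>
          deriv (deriv s) 0 =
            2 / l * (l2_inner l uh v / (vector_derivative v (at l within {0..l}))\<^sup>2))) \<and>
    (\<forall>u. 0 \<in> Spec l (schrodinger l g) - Spec l (schrodinger l h) \<and>
         u \<in> ker (schrodinger l g) \<and> u \<noteq> 0 \<longrightarrow>
       vector_derivative u (at l within {0..l}) \<noteq> 0 \<and>
       (\<exists>!vh. (vh, - u) \<in> schrodinger l h) \<and>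
       (\<forall>vh. (vh, - u) \<in> schrodinger l h \<longrightarrow>
          deriv (deriv s) 0 =
            - (2 / l) * (l2_inner l vh u / (vector_derivative u (at l within {0..l}))\<^sup>2)))"
proof -
  have l: "0 < l" "l < l'" by fact+
  have g: "continuous_on {0..l'} g" and h: "continuous_on {0..l'} h"
    using assms(3,4) Ck_on_imp_continuous by blast+
  have gl: "continuous_on {0..l} g" and hl: "continuous_on {0..l} h"
    using l g h by (auto elim: continuous_on_subset)
  have l'0: "0 \<le> l'" using l by simp
  obtain a a1 where a: "ode_solution l' g (\<lambda>_. 0) a a1" "a 0 = 0" "a1 0 = 1"
    by (rule ode_solution_exists[OF g l'0 continuous_on_const])
  obtain b b1 where b: "ode_solution l' h (\<lambda>_. 0) b b1" "b 0 = 0" "b1 0 = 1"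
    by (rule ode_solution_exists[OF h l'0 continuous_on_const])
  note al = ode_solution_restrict[OF a(1) less_imp_le[OF l(2)]]
    and bl = ode_solution_restrict[OF b(1) less_imp_le[OF l(2)]]
  have dichotomy: "a l = 0 \<longleftrightarrow> b l \<noteq> 0"
    by (rule opN_simple_kernel[OF l(1) gl hl al a(2,3) bl b(2,3) assms(5)])
  show ?thesis
  proof (cases "b l = 0")
    case True
    then have al0: "a l \<noteq> 0" using dichotomy by simp
    obtain r s where r: "0 < r" "smooth_relative_to {0..l'} g h r s" "s 0 = 1"
      "\<And>z. \<bar>z\<bar> < r \<Longrightarrow> 0 < s z \<and> s z * l \<le> l' \<and> dirichlet_eigenvalue g h (s z * l) z"
      "deriv s 0 = 0"
      and con: "\<And>v. v \<in> ker (schrodinger l h) \<Longrightarrow> v \<noteq> 0 \<Longrightarrow>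
       continuous_on {0..l} v \<and> vector_derivative v (at l within {0..l}) \<noteq> 0 \<and>
       (\<forall>y. (y, v) \<in> schrodinger l g \<longrightarrow> deriv (deriv s) 0 =
            2 / l * (l2_inner l y v / (vector_derivative v (at l within {0..l}))\<^sup>2))"
      by (rule eigenvalue_curve_concavity[OF l g h a al0 b True], rule that)
    show ?thesis
    proof (intro exI[of _ r] exI[of _ s] conjI allI impI)
      fix v assume "0 \<in> Spec l (schrodinger l h) - Spec l (schrodinger l g) \<and>
         v \<in> ker (schrodinger l h) \<and> v \<noteq> 0"
      then have v: "v \<in> ker (schrodinger l h)" "v \<noteq> 0" by auto
      show "vector_derivative v (at l within {0..l}) \<noteq> 0" using con[OF v] by blast
      show "\<exists>!uh. (uh, v) \<in> schrodinger l g"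
        using con[OF v] by (intro schrodinger_uniquely_solvable[OF gl l(1) _ al a(2,3) al0]) blast
      show "deriv (deriv s) 0 = 2 / l * (l2_inner l uh v / (vector_derivative v (at l within {0..l}))\<^sup>2)"
        if "(uh, v) \<in> schrodinger l g" for uh using con[OF v] that by blast
    next
      fix u assume "0 \<in> Spec l (schrodinger l g) - Spec l (schrodinger l h) \<and>
         u \<in> ker (schrodinger l g) \<and> u \<noteq> 0"
      then have False using ker_schrodinger_trivial[OF gl l(1) al a(2,3) al0] by blast
      then show "vector_derivative u (at l within {0..l}) \<noteq> 0"
        "\<exists>!vh. (vh, - u) \<in> schrodinger l h"
        "\<And>vh. deriv (deriv s) 0 = - (2 / l) * (l2_inner l vh u / (vector_derivative u (at l within {0..l}))\<^sup>2)"
        by blast+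
    qed (use r in auto)
  next
    case False
    \<comment> \<open>The same argument with the potentials exchanged; the curve serves both systems.\<close>
    then have al0: "a l = 0" using dichotomy by simp
    obtain r s where r: "0 < r" "smooth_relative_to {0..l'} h g r s" "s 0 = 1"
      "\<And>z. \<bar>z\<bar> < r \<Longrightarrow> 0 < s z \<and> s z * l \<le> l' \<and> dirichlet_eigenvalue h g (s z * l) z"
      "deriv s 0 = 0"
      and con: "\<And>v. v \<in> ker (schrodinger l g) \<Longrightarrow> v \<noteq> 0 \<Longrightarrow>
       continuous_on {0..l} v \<and> vector_derivative v (at l within {0..l}) \<noteq> 0 \<and>
       (\<forall>y. (y, v) \<in> schrodinger l h \<longrightarrow> deriv (deriv s) 0 =
            2 / l * (l2_inner l y v / (vector_derivative v (at l within {0..l}))\<^sup>2))"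
      by (rule eigenvalue_curve_concavity[OF l h g b False a al0], rule that)
    show ?thesis
    proof (intro exI[of _ r] exI[of _ s] conjI allI impI)
      fix v assume "0 \<in> Spec l (schrodinger l h) - Spec l (schrodinger l g) \<and>
         v \<in> ker (schrodinger l h) \<and> v \<noteq> 0"
      then have False using ker_schrodinger_trivial[OF hl l(1) bl b(2,3) False] by blast
      then show "vector_derivative v (at l within {0..l}) \<noteq> 0"
        "\<exists>!uh. (uh, v) \<in> schrodinger l g"
        "\<And>uh. deriv (deriv s) 0 = 2 / l * (l2_inner l uh v / (vector_derivative v (at l within {0..l}))\<^sup>2)"
        by blast+
    next
      fix u assume "0 \<in> Spec l (schrodinger l g) - Spec l (schrodinger l h) \<and>
         u \<in> ker (schrodinger l g) \<and> u \<noteq> 0"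
      then have u: "u \<in> ker (schrodinger l g)" "u \<noteq> 0" by auto
      have mu: "continuous_on {0..l} (- u)"
        using con[OF u] continuous_on_minus[of "{0..l}" u] by (simp add: fun_Compl_def)
      show "vector_derivative u (at l within {0..l}) \<noteq> 0" using con[OF u] by blast
      show "\<exists>!vh. (vh, - u) \<in> schrodinger l h"
        by (rule schrodinger_uniquely_solvable[OF hl l(1) mu bl b(2,3) False])
      show "deriv (deriv s) 0 = - (2 / l) * (l2_inner l vh u / (vector_derivative u (at l within {0..l}))\<^sup>2)"
        if "(vh, - u) \<in> schrodinger l h" for vh
      proof -
        have "(- vh, u) \<in> schrodinger l h"
          using schrodinger_uminus[OF hl mu l(1) that] by simp
        then have "deriv (deriv s) 0 =
            2 / l * (l2_inner l (- vh) u / (vector_derivative u (at l within {0..l}))\<^sup>2)"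
          using con[OF u] by blast
        moreover have "l2_inner l (- vh) u = - l2_inner l vh u" by (simp add: l2_inner_def)
        ultimately show ?thesis by simp
      qed
    next
      show "smooth_relative_to {0..l'} g h r s"
        using r(2) unfolding smooth_relative_to_def by blast
      show "dirichlet_eigenvalue g h (s z * l) z" if "\<bar>z\<bar> < r" for z
        using r(4)[OF that] dirichlet_eigenvalue_swap by blast
    qed (use r in auto)
  qed
qed

end
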